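(* Let $T\in\mathcal{L}(H)$ have the polar decomposition $T=U|T|$. Then the following statements are equivalent: (i) $T$ is a centered operator; (ii) for each $k\in\mathbb{N}$, $T^k=U^k|T^k|$ is the polar decomposition of $T^k$; (iii) for each $n\in\mathbb{N}$, $T$ is an $n$-centered operator.
   Context: $\mathbb{N}$ is the set of positive integers. $\mathfrak{A}$ is a $C^*$-algebra, $H$ is a (right) Hilbert $\mathfrak{A}$-module, and $\mathcal{L}(H)$ is the $C^*$-algebra of adjointable operators on $H$. For $T\in\mathcal{L}(H)$, $|T|=(T^*T)^{1/2}$, and $\mathcal{R}(T)$ is the range of $T$. A closed submodule $M\subseteq H$ is orthogonally complemented if $H=M\dotplus M^\perp$; then $P_M$ denotes the projection from $H$ onto $M$. An element $W\in\mathcal{L}(H)$ is a partial isometry if $W^*W$ is a projection. "$T=U|T|$ is the polar decomposition of $T$" means: $U\in\mathcal{L}(H)$ is a partial isometry, $T=U|T|$, $\overline{\mathcal{R}(T^* )}$ is orthogonally complemented, and $U^*U=P_{\overline{\mathcal{R}(T^* )}}$. (Such a $U$ is unique when it exists, and it exists if and only if both $\overline{\mathcal{R}(T^* )}$ and $\overline{\mathcal{R}(T)}$ are orthogonally complemented.) If $T$ has the polar decomposition $T=U|T|$ and $n\in\mathbb{N}$, then $T$ is called $n$-centered if $T^k=U^k|T^k|$ is the polar decomposition of $T^k$ for $k=1,2,\dots,n$. An element $T\in\mathcal{L}(H)$ is called centered if the sequence $\dots,T^3(T^3)^*,T^2(T^2)^*,TT^*,T^*T,(T^2)^*T^2,(T^3)^*T^3,\dots$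 consists of mutually commuting operators. *)

theory Defs
  imports "HOL-Analysis.Analysis"
begin

class complex_banach = banach +
  fixes scaleC :: "complex \<Rightarrow> 'a \<Rightarrow> 'a"  (infixr \<open>*\<^sub>C\<close> 75)
  assumes scaleC_add_right: "z *\<^sub>C (x + y) = z *\<^sub>C x + z *\<^sub>C y"
    and scaleC_add_left: "(z + w) *\<^sub>C x = z *\<^sub>C x + w *\<^sub>C x"
    and scaleC_scaleC: "z *\<^sub>C w *\<^sub>C x = (z * w) *\<^sub>C x"
    and scaleC_of_real: "complex_of_real r *\<^sub>C x = r *\<^sub>R x"
    and norm_scaleC: "norm (z *\<^sub>C x) = cmod z * norm x"

text \<open>Not assumed to be unital.\<close>

class cstar_algebra = complex_banach + real_normed_algebra +
  fixes star :: "'a \<Rightarrow> 'a"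
  assumes mult_scaleC_left: "(z *\<^sub>C a) * b = z *\<^sub>C (a * b)"
    and mult_scaleC_right: "a * (z *\<^sub>C b) = z *\<^sub>C (a * b)"
    and star_add: "star (a + b) = star a + star b"
    and star_scaleC: "star (z *\<^sub>C a) = cnj z *\<^sub>C star a"
    and star_mult: "star (a * b) = star b * star a"
    and star_star: "star (star a) = a"
    and cstar_identity: "norm (star a * a) = (norm a)\<^sup>2"

definition positive :: "'a::cstar_algebra \<Rightarrow> bool"
  where "positive a \<longleftrightarrow> (\<exists>b. a = star b * b)"

text \<open>Right Hilbert modules, with inner product linear in the second argument. The module is
  the whole type \<open>'h\<close>. Its norm is required to be the one induced by the inner product, so
  that completeness with respect to that norm is contained in the class constraint, and the
  library's \<^const>\<open>closure\<close> and \<^const>\<open>closed\<close> refer to the norm topology of the module.\<close>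

locale hilbert_module =
  fixes act :: "'h::complex_banach \<Rightarrow> 'a::cstar_algebra \<Rightarrow> 'h"  (infixl \<open>\<cdot>\<close> 75)
    and ip :: "'h \<Rightarrow> 'h \<Rightarrow> 'a"
  assumes act_add_left: "(x + y) \<cdot> a = x \<cdot> a + y \<cdot> a"
    and act_add_right: "x \<cdot> (a + b) = x \<cdot> a + x \<cdot> b"
    and act_mult: "x \<cdot> (a * b) = (x \<cdot> a) \<cdot> b"
    and act_scaleC_left: "(z *\<^sub>C x) \<cdot> a = z *\<^sub>C (x \<cdot> a)"
    and act_scaleC_right: "x \<cdot> (z *\<^sub>C a) = z *\<^sub>C (x \<cdot> a)"
    and ip_add_right: "ip x (y + w) = ip x y + ip x w"
    and ip_scaleC_right: "ip x (z *\<^sub>C y) = z *\<^sub>C ip x y"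
    and ip_act_right: "ip x (y \<cdot> a) = ip x y * a"
    and ip_star: "star (ip x y) = ip y x"
    and ip_positive: "positive (ip x x)"
    and ip_definite: "ip x x = 0 \<Longrightarrow> x = 0"
    and norm_ip: "norm x = sqrt (norm (ip x x))"
begin

text \<open>Linearity, \<open>'a\<close>-linearity and boundedness of an adjointable map are consequences of the
  existence of an adjoint, and the adjoint is unique.\<close>

definition adjointable :: "('h \<Rightarrow> 'h) \<Rightarrow> bool"
  where "adjointable T \<longleftrightarrow> (\<exists>S. \<forall>x y. ip (T x) y = ip x (S y))"

definition adj :: "('h \<Rightarrow> 'h) \<Rightarrow> 'h \<Rightarrow> 'h"
  where "adj T = (THE S. \<forall>x y. ip (T x) y = ip x (S y))"

text \<open>Positivity in the \<open>C\<^sup>*\<close>-algebra of adjointable operators.\<close>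

definition positive_op :: "('h \<Rightarrow> 'h) \<Rightarrow> bool"
  where "positive_op S \<longleftrightarrow> (\<exists>R. adjointable R \<and> S = adj R \<circ> R)"

text \<open>The unique positive square root of \<open>T\<^sup>* T\<close>.\<close>

definition abs_op :: "('h \<Rightarrow> 'h) \<Rightarrow> 'h \<Rightarrow> 'h"
  where "abs_op T = (THE S. positive_op S \<and> S \<circ> S = adj T \<circ> T)"

definition projection :: "('h \<Rightarrow> 'h) \<Rightarrow> bool"
  where "projection P \<longleftrightarrow> adjointable P \<and> adj P = P \<and> P \<circ> P = P"

definition partial_isometry :: "('h \<Rightarrow> 'h) \<Rightarrow> bool"
  where "partial_isometry W \<longleftrightarrow> adjointable W \<and> projection (adj W \<circ> W)"

definition submodule :: "'h set \<Rightarrow> bool"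
  where "submodule M \<longleftrightarrow> 0 \<in> M \<and> (\<forall>x\<in>M. \<forall>y\<in>M. x + y \<in> M) \<and>
    (\<forall>x\<in>M. \<forall>z. z *\<^sub>C x \<in> M) \<and> (\<forall>x\<in>M. \<forall>a. x \<cdot> a \<in> M)"

definition orth_compl :: "'h set \<Rightarrow> 'h set"
  where "orth_compl M = {y. \<forall>x\<in>M. ip x y = 0}"

definition orth_complemented :: "'h set \<Rightarrow> bool"
  where "orth_complemented M \<longleftrightarrow> closed M \<and> submodule M \<and>
    {x + y |x y. x \<in> M \<and> y \<in> orth_compl M} = UNIV \<and> M \<inter> orth_compl M = {0}"

text \<open>Meaningful only for orthogonally complemented \<open>M\<close>.\<close>

definition proj_onto :: "'h set \<Rightarrow> 'h \<Rightarrow> 'h"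
  where "proj_onto M x = (THE m. m \<in> M \<and> x - m \<in> orth_compl M)"

definition polar_decomposition :: "('h \<Rightarrow> 'h) \<Rightarrow> ('h \<Rightarrow> 'h) \<Rightarrow> bool"
  where "polar_decomposition T U \<longleftrightarrow> partial_isometry U \<and> T = U \<circ> abs_op T \<and>
    orth_complemented (closure (range (adj T))) \<and>
    adj U \<circ> U = proj_onto (closure (range (adj T)))"

text \<open>The factor \<open>U\<close> is unique when it exists, so the existential quantifier refers to the
  partial isometry of the polar decomposition of \<open>T\<close>.\<close>

definition n_centered :: "nat \<Rightarrow> ('h \<Rightarrow> 'h) \<Rightarrow> bool"
  where "n_centered n T \<longleftrightarrow> (\<exists>U. polar_decomposition T U \<and>
    (\<forall>k\<in>{1..n}. polar_decomposition (T ^^ k) (U ^^ k)))"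

definition centered :: "('h \<Rightarrow> 'h) \<Rightarrow> bool"
  where "centered T \<longleftrightarrow>
    (let C = {T ^^ k \<circ> adj (T ^^ k) |k. k \<ge> 1} \<union> {adj (T ^^ k) \<circ> T ^^ k |k. k \<ge> 1}
     in \<forall>A\<in>C. \<forall>B\<in>C. A \<circ> B = B \<circ> A)"

end

end

theory Submission
  imports Defs
begin

text \<open>
  Everything rests on the behaviour of polar decompositions under composition. Let \<open>T = U|T|\<close>
  and \<open>S = V|S|\<close> be polar decompositions. Then \<open>TS = UV|TS|\<close> is a polar decomposition if and
  only if \<open>T\<^sup>*T\<close> and \<open>SS\<^sup>*\<close> commute (\<open>polar_decomposition_comp\<close> and
  \<open>polar_decomposition_comp_imp_commute\<close>). Applied to \<open>T\<close> and \<open>T\<^sup>k\<close>, the first direction gives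
  by induction that the powers of a centered operator have the polar decompositions
  \<open>U\<^sup>k|T\<^sup>k|\<close>. Applied to \<open>T\<^sup>j\<close> and \<open>T\<^sup>k\<close>, the second direction gives back that every
  \<open>T\<^sup>j\<^sup>*T\<^sup>j\<close> commutes with every \<open>T\<^sup>kT\<^sup>k\<^sup>*\<close>. The remaining commutation relations of a centered
  operator follow from these mixed ones, because for \<open>j < k\<close> the operator \<open>T\<^sup>kT\<^sup>k\<^sup>*\<close> is
  \<open>T\<^sup>j (T\<^bsup>k-j\<^esup>T\<^bsup>k-j\<^esup>\<^sup>*) T\<^sup>j\<^sup>*\<close> and dually (\<open>centered_iff\<close>). The statement about \<open>n\<close>-centered
  operators is then the uniqueness of the partial isometry in a polar decomposition.

  Behind the composition theorem is a description of polar decompositions without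
  absolute values: a partial isometry \<open>U\<close> is the one of \<open>T\<close> exactly if \<open>U\<^sup>*T\<close> is positive, \<open>UU\<^sup>*T = T\<close>
  and \<open>U\<^sup>*U\<close> has range the closure of the range of \<open>T\<^sup>*\<close> (\<open>polar_decomposition_iff\<close>).

  This needs that \<open>|T|\<close> exists and is unique, and that it commutes with whatever commutes with
  \<open>T\<^sup>*T\<close>, where positivity means being of the form \<open>R\<^sup>*R\<close>. The argument avoids
  spectral theory. For \<open>\<parallel>x\<parallel> \<le> 1\<close> a square root of \<open>1 - x\<close> is the limit of an explicit iteration.
  If self-adjoint commuting \<open>a\<close>, \<open>b\<close> satisfy \<open>a\<^sup>2 + b\<^sup>2 = 1\<close>, then \<open>a + ib\<close> is isometric, so \<open>\<parallel>a\<parallel> \<le> 1\<close>;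
  this replaces the norm estimates of the functional calculus. It follows that the squares of
  self-adjoint operators form a pointed convex cone in which square roots exist and are unique.
  Finally every \<open>R\<^sup>*R\<close> lies in that cone (\<open>psd_adjoint_mult\<close>), a theorem of Fukamiya and Kaplansky.
\<close>

section \<open>Square roots in Banach algebras\<close>

text \<open>
  The root is \<open>1 - y\<close>, where \<open>y\<close> solves \<open>y = (x + y\<^sup>2) / 2\<close>. Iterating this equation from \<open>0\<close>
  converges even for \<open>\<parallel>x\<parallel> = 1\<close>, where it is no contraction, since all norms are dominated by the
  iteration of the same equation for the number \<open>1\<close>, which increases to \<open>1\<close>. The last property of
  \<open>y\<close> says that it inherits from \<open>x\<close> all that survives the iteration and the limit: it will be
  used for self-adjointness and for commuting with a given element.
\<close>

lemma square_root_one_minus: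
  fixes x :: "'b::{real_normed_algebra, monoid_mult, banach}"
  assumes x: "norm x \<le> 1"
  obtains y where "norm y \<le> 1" "(1 - y) * (1 - y) = 1 - x"
    "\<And>C. closed C \<Longrightarrow> 0 \<in> C \<Longrightarrow> (\<And>z. z \<in> C \<Longrightarrow> (1/2) *\<^sub>R (x + z * z) \<in> C) \<Longrightarrow> y \<in> C"
proof -
  define Y where "Y = rec_nat 0 (\<lambda>_ z. (1/2) *\<^sub>R (x + z * z))"
  define t :: "nat \<Rightarrow> real" where "t = rec_nat 0 (\<lambda>_ s. (1/2) * (1 + s * s))"
  have Y0: "Y 0 = 0" and YS: "Y (Suc n) = (1/2) *\<^sub>R (x + Y n * Y n)" for n
    by (simp_all add: Y_def)
  have t0: "t 0 = 0" and tS: "t (Suc n) = (1/2) * (1 + t n * t n)" for n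
    by (simp_all add: t_def)
  have t_bounds: "0 \<le> t n \<and> t n \<le> 1" for n
  proof (induction n)
    case (Suc n)
    then have "t n * t n \<le> 1" "0 \<le> t n * t n" by (auto simp: mult_le_one)
    then show ?case by (simp add: tS)
  qed (simp add: t0)
  have t_step: "t n \<le> t (Suc n)" for n
  proof -
    have "2 * (t (Suc n) - t n) = (1 - t n) * (1 - t n)" by (simp add: tS algebra_simps)
    then show ?thesis by (smt (verit) zero_le_square)
  qed
  have Y_bound: "norm (Y n) \<le> t n" for n
  proof (induction n)
    case (Suc n)
    have "norm (x + Y n * Y n) \<le> 1 + t n * t n"
      by (intro order_trans[OF norm_triangle_ineq] add_mono x order_trans[OF norm_mult_ineq] mult_mono Suc)
        (use t_bounds in auto)
    then show ?case by (simp add: YS tS)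
  qed (simp add: Y0 t0)
  \<comment> \<open>The increments of the iteration are dominated by those of the scalar one, which telescope.\<close>
  have Y_step: "norm (Y (Suc n) - Y n) \<le> t (Suc n) - t n" for n
  proof (induction n)
    case 0
    show ?case using x by (simp add: YS Y0 tS t0)
  next
    case (Suc n)
    let ?a = "Y (Suc n)" and ?b = "Y n"
    have "Y (Suc (Suc n)) - Y (Suc n) = (1/2) *\<^sub>R (?a * (?a - ?b) + (?a - ?b) * ?b)"
      by (subst (1 2) YS) (simp add: algebra_simps)
    moreover have "norm (?a * (?a - ?b) + (?a - ?b) * ?b)
        \<le> t (Suc n) * (t (Suc n) - t n) + (t (Suc n) - t n) * t n"
      by (intro order_trans[OF norm_triangle_ineq] add_mono order_trans[OF norm_mult_ineq]
          mult_mono Suc Y_bound) (use t_bounds t_step in auto)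
    moreover have "\<dots> = 2 * (t (Suc (Suc n)) - t (Suc n))"
      by (subst (4) tS) (simp add: tS algebra_simps)
    ultimately show ?case by simp
  qed
  have t_diff: "t m \<le> t n" and Y_diff: "norm (Y n - Y m) \<le> t n - t m" if "m \<le> n" for m n
    using that
  proof (induction n rule: dec_induct)
    case (step n)
    { case 1 show ?case using step t_step[of n] by linarith }
    { case 2
      have "norm (Y (Suc n) - Y m) \<le> norm (Y (Suc n) - Y n) + norm (Y n - Y m)"
        by (metis diff_add_cancel add_diff_eq norm_triangle_ineq)
      then show ?case using step Y_step[of n] by linarith }
  qed auto
  have "convergent t"
    by (rule Bseq_mono_convergent) (use t_bounds t_diff in \<open>auto intro!: BseqI'[of _ 1]\<close>)
  then have t_Cauchy: "Cauchy t" by (rule convergent_Cauchy)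
  have "Cauchy Y"
  proof (rule CauchyI)
    fix e :: real assume "e > 0"
    then obtain M where M: "\<And>m n. M \<le> m \<Longrightarrow> M \<le> n \<Longrightarrow> norm (t m - t n) < e"
      using CauchyD[OF t_Cauchy] by blast
    have "norm (Y m - Y n) < e" if "M \<le> m" "M \<le> n" for m n
      using M[OF that] Y_diff[of m n] Y_diff[of n m] norm_minus_commute[of "Y m" "Y n"]
      by (cases "m \<le> n") auto
    then show "\<exists>M. \<forall>m\<ge>M. \<forall>n\<ge>M. norm (Y m - Y n) < e" by blast
  qed
  then obtain y where y: "Y \<longlonglongrightarrow> y"
    using Cauchy_convergent convergent_def by blast
  show thesis
  proof
    show "norm y \<le> 1"
      by (rule LIMSEQ_le_const2[OF tendsto_norm[OF y]]) (use Y_bound t_bounds order_trans in blast)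
    have "(\<lambda>n. Y (Suc n)) \<longlonglongrightarrow> (1/2) *\<^sub>R (x + y * y)"
      unfolding YS by (intro tendsto_intros y)
    then have "y = (1/2) *\<^sub>R (x + y * y)"
      using LIMSEQ_unique LIMSEQ_Suc[OF y] by blast
    then have "y + y = x + y * y"
      by (metis scaleR_2 scaleR_scaleR scaleR_one mult_2 field_sum_of_halves scaleR_half_double scaleR_right_distrib)
    then show "(1 - y) * (1 - y) = 1 - x"
      by (simp add: algebra_simps)
    show "y \<in> C" if C: "closed C" "0 \<in> C" "\<And>z. z \<in> C \<Longrightarrow> (1/2) *\<^sub>R (x + z * z) \<in> C" for C
    proof -
      have "Y n \<in> C" for n by (induction n) (auto simp: Y0 YS C)
      then show ?thesis using C(1) y closed_sequentially by blast
    qed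
  qed
qed

section \<open>Bounded operators as a Banach algebra\<close>

text \<open>
  The bounded linear endomorphisms get a type of their own because composition can be made the
  multiplication of a type class only if source and target coincide. The space may be
  zero, in which case \<open>0 = 1\<close>; the ring structure is therefore \<^class>\<open>real_normed_algebra\<close>
  together with \<^class>\<open>monoid_mult\<close>, which also fixes no value for \<open>\<parallel>1\<parallel>\<close>.
\<close>

typedef (overloaded) 'v endo = "UNIV :: ('v::real_normed_vector \<Rightarrow>\<^sub>L 'v) set"
  morphisms blinfun_of_endo endo_of_blinfun by simp

setup_lifting type_definition_endo

instantiation endo :: (real_normed_vector) "{real_normed_algebra, monoid_mult}"
begin

lift_definition zero_endo :: "'a endo" is 0 .
lift_definition one_endo :: "'a endo" is id_blinfun .
lift_definition plus_endo :: "'a endo \<Rightarrow> 'a endo \<Rightarrow> 'a endo" is "(+)" .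
lift_definition minus_endo :: "'a endo \<Rightarrow> 'a endo \<Rightarrow> 'a endo" is "(-)" .
lift_definition uminus_endo :: "'a endo \<Rightarrow> 'a endo" is uminus .
lift_definition times_endo :: "'a endo \<Rightarrow> 'a endo \<Rightarrow> 'a endo" is blinfun_compose .
lift_definition scaleR_endo :: "real \<Rightarrow> 'a endo \<Rightarrow> 'a endo" is scaleR .
lift_definition norm_endo :: "'a endo \<Rightarrow> real" is norm .
definition dist_endo :: "'a endo \<Rightarrow> 'a endo \<Rightarrow> real" where "dist_endo a b = norm (a - b)"
definition sgn_endo :: "'a endo \<Rightarrow> 'a endo" where "sgn_endo a = scaleR (inverse (norm a)) a"
definition uniformity_endo :: "('a endo \<times> 'a endo) filter"
  where [code del]: "uniformity_endo = (INF e\<in>{0 <..}. principal {(x, y). dist x y < e})"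
definition open_endo :: "'a endo set \<Rightarrow> bool"
  where [code del]: "open_endo S = (\<forall>x\<in>S. \<forall>\<^sub>F (x', y) in uniformity. x' = x \<longrightarrow> y \<in> S)"

instance
proof
  interpret comp: bounded_bilinear "blinfun_compose :: ('a \<Rightarrow>\<^sub>L 'a) \<Rightarrow> _"
    by (rule bounded_bilinear_blinfun_compose)
  fix a b c :: "'a endo" and r s :: real
  show "a + b + c = a + (b + c)" "a + b = b + a" "0 + a = a" "- a + a = 0" "a - b = a + - b"
    "r *\<^sub>R (a + b) = r *\<^sub>R a + r *\<^sub>R b" "(r + s) *\<^sub>R a = r *\<^sub>R a + s *\<^sub>R a"
    "r *\<^sub>R s *\<^sub>R a = (r * s) *\<^sub>R a" "1 *\<^sub>R a = a"
    "norm a = 0 \<longleftrightarrow> a = 0" "norm (a + b) \<le> norm a + norm b" "norm (r *\<^sub>R a) = \<bar>r\<bar> * norm a"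
    by (transfer; simp add: algebra_simps norm_triangle_ineq; fail)+
  show "a * b * c = a * (b * c)" "1 * a = a" "a * 1 = a"
    by (transfer; auto intro: blinfun_eqI; fail)+
  show "(a + b) * c = a * c + b * c" "a * (b + c) = a * b + a * c"
    "r *\<^sub>R a * b = r *\<^sub>R (a * b)" "a * r *\<^sub>R b = r *\<^sub>R (a * b)"
    by (transfer; simp add: comp.add_left comp.add_right comp.scaleR_left comp.scaleR_right; fail)+
  show "norm (a * b) \<le> norm a * norm b"
    by transfer (rule norm_blinfun_compose)
qed (simp_all add: dist_endo_def sgn_endo_def uniformity_endo_def open_endo_def)

end

instance endo :: (banach) banach
proof
  fix X :: "nat \<Rightarrow> 'a endo"
  assume X: "Cauchy X"
  have dist_eq: "dist (blinfun_of_endo a) (blinfun_of_endo b) = dist a b" for a b :: "'a endo"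
    unfolding dist_norm by transfer (rule refl)
  from X have "Cauchy (\<lambda>n. blinfun_of_endo (X n))"
    unfolding Cauchy_def dist_eq .
  then obtain L where "(\<lambda>n. blinfun_of_endo (X n)) \<longlonglongrightarrow> L"
    using Cauchy_convergent convergent_def by blast
  then have "X \<longlonglongrightarrow> endo_of_blinfun L"
    by (simp add: tendsto_dist_iff[of X] tendsto_dist_iff[of _ L] flip: dist_eq)
      (simp add: endo_of_blinfun_inverse)
  then show "convergent X" by (auto simp: convergent_def)
qed

lift_definition app :: "'v::real_normed_vector endo \<Rightarrow> 'v \<Rightarrow> 'v" is blinfun_apply .

lemma app_simps [simp]:
  "app (a * b) x = app a (app b x)" "app 1 x = x" "app 0 x = 0"
  "app (a + b) x = app a x + app b x" "app (a - b) x = app a x - app b x"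
  "app (- a) x = - app a x" "app (r *\<^sub>R a) x = r *\<^sub>R app a x"
  by (transfer; simp add: blinfun.bilinear_simps; fail)+

lemma app_linear [simp]:
  "app a (x + y) = app a x + app a y" "app a (x - y) = app a x - app a y"
  "app a (- x) = - app a x" "app a (r *\<^sub>R x) = r *\<^sub>R app a x" "app a 0 = 0"
  by (transfer; simp add: blinfun.bilinear_simps; fail)+

lemma norm_app: "norm (app a x) \<le> norm a * norm x"
  by transfer (rule norm_blinfun)

lemma norm_endo_bound: "0 \<le> b \<Longrightarrow> (\<And>x. norm (app a x) \<le> b * norm x) \<Longrightarrow> norm a \<le> b"
  by transfer (rule norm_blinfun_bound)

lemma endo_eqI: "(\<And>x. app a x = app b x) \<Longrightarrow> a = b"
  by transfer (rule blinfun_eqI)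

lemma bounded_linear_endo:
  assumes "bounded_linear f"
  obtains a where "app a = f"
proof
  show "app (endo_of_blinfun (Blinfun f)) = f"
    by (simp add: app.rep_eq endo_of_blinfun_inverse bounded_linear_Blinfun_apply assms)
qed

lemma bounded_linear_app_left: "bounded_linear (\<lambda>a. app a x)"
  by (rule bounded_linear_intro[where K = "norm x"]) (auto simp: norm_app)

section \<open>Inner products and adjointable maps\<close>

lemma scaleC_minus1: "(- 1) *\<^sub>C x = - (x :: 'v::complex_banach)"
  using scaleC_of_real[of "-1" x] by simp

lemma scaleC_one: "1 *\<^sub>C x = (x :: 'v::complex_banach)"
  using scaleC_of_real[of 1 x] by simp

lemma scaleC_zero: "0 *\<^sub>C x = (0 :: 'v::complex_banach)"
  using scaleC_of_real[of 0 x] by simp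

lemma scaleC_minus_left: "(- z) *\<^sub>C x = - (z *\<^sub>C (x :: 'v::complex_banach))"
  using scaleC_scaleC[of "-1" z x] by (simp add: scaleC_minus1)

lemma scaleC_minus_right: "z *\<^sub>C (- x) = - (z *\<^sub>C (x :: 'v::complex_banach))"
  using scaleC_scaleC[of z "-1" x] by (simp add: scaleC_minus1 scaleC_minus_left scaleC_one)

lemma scaleR_scaleC: "r *\<^sub>R x = complex_of_real r *\<^sub>C (x :: 'v::complex_banach)"
  by (simp add: scaleC_of_real)

context hilbert_module
begin

lemma ip_add_left: "ip (x + y) z = ip x z + ip y z"
  by (metis ip_add_right ip_star star_add)

lemma ip_scaleC_left: "ip (z *\<^sub>C x) y = cnj z *\<^sub>C ip x y"
  by (metis ip_scaleC_right ip_star star_scaleC)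

lemma ip_scaleR_right: "ip x (r *\<^sub>R y) = r *\<^sub>R ip x y"
  by (simp add: scaleR_scaleC ip_scaleC_right)

lemma ip_scaleR_left: "ip (r *\<^sub>R x) y = r *\<^sub>R ip x y"
  by (simp add: scaleR_scaleC ip_scaleC_left)

lemma ip_minus_right: "ip x (- y) = - ip x y"
  using ip_scaleR_right[of x "-1" y] by simp

lemma ip_minus_left: "ip (- x) y = - ip x y"
  using ip_scaleR_left[of "-1" x y] by simp

lemma ip_diff_right: "ip x (y - z) = ip x y - ip x z"
  using ip_add_right[of x y "- z"] by (simp add: ip_minus_right)

lemma ip_diff_left: "ip (x - y) z = ip x z - ip y z"
  using ip_add_left[of x "- y" z] by (simp add: ip_minus_left)

lemma ip_norm: "(norm x)\<^sup>2 = norm (ip x x)"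
  by (simp add: norm_ip)

lemma polarization:
  "4 *\<^sub>R ip x y = ip (x + y) (x + y) - ip (x - y) (x - y)
     - \<i> *\<^sub>C (ip (x + \<i> *\<^sub>C y) (x + \<i> *\<^sub>C y) - ip (x - \<i> *\<^sub>C y) (x - \<i> *\<^sub>C y))"
  (is "_ = ?rhs")
proof -
  have diff: "ip (u + v) (u + v) - ip (u - v) (u - v) = 2 *\<^sub>R (ip u v + ip v u)" for u v
    by (simp add: ip_add_left ip_add_right ip_diff_left ip_diff_right algebra_simps scaleR_2)
  have i2: "\<i> * (2 * \<i>) = - 2" by (simp add: complex_eq_iff)
  have "\<i> *\<^sub>C (2 *\<^sub>R (ip x (\<i> *\<^sub>C y) + ip (\<i> *\<^sub>C y) x)) = 2 *\<^sub>R (ip y x - ip x y)"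
    by (simp add: scaleR_scaleC ip_scaleC_left ip_scaleC_right scaleC_scaleC scaleC_add_right i2
        diff_conv_add_uminus[of "ip y x"] flip: scaleC_minus1[of "ip x y"])
  then have "?rhs = 2 *\<^sub>R (ip x y + ip y x) - 2 *\<^sub>R (ip y x - ip x y)"
    by (simp only: diff)
  also have "\<dots> = (2 + 2) *\<^sub>R ip x y"
    unfolding scaleR_left_distrib by (simp add: algebra_simps)
  finally show ?thesis by simp
qed

text \<open>
  By polarization the norm of \<open>ip x y\<close> for unit vectors is at most \<open>4\<close>, since the vectors
  \<open>x \<plusminus> y\<close> and \<open>x \<plusminus> iy\<close> have norm at most \<open>2\<close>. The purpose is continuity of the inner product, so
  the constant is not optimised to that of the Cauchy-Schwarz inequality.
\<close>

lemma norm_ip_le: "norm (ip x y) \<le> norm x * norm y * 4"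
proof -
  have unit: "norm (ip u v) \<le> 4" if "norm u \<le> 1" "norm v \<le> 1" for u v
  proof -
    have sq: "norm (ip w w) \<le> 4" if "norm w \<le> 2" for w
      using power_mono[OF that, of 2] by (simp add: ip_norm)
    have le: "norm (u + w) \<le> 2 \<and> norm (u - w) \<le> 2" if "norm w \<le> 1" for w
      using that \<open>norm u \<le> 1\<close> norm_triangle_ineq[of u w] norm_triangle_ineq4[of u w] by linarith
    have "norm (\<i> *\<^sub>C v) \<le> 1" by (simp add: norm_scaleC that)
    note bounds = le[OF \<open>norm v \<le> 1\<close>] le[OF this]
    have "norm (4 *\<^sub>R ip u v) \<le> (norm (ip (u + v) (u + v)) + norm (ip (u - v) (u - v)))
       + (norm (ip (u + \<i> *\<^sub>C v) (u + \<i> *\<^sub>C v)) + norm (ip (u - \<i> *\<^sub>C v) (u - \<i> *\<^sub>C v)))"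
      unfolding polarization
      by (intro order_trans[OF norm_triangle_ineq4] add_mono) (simp_all add: norm_scaleC norm_triangle_ineq4)
    also have "\<dots> \<le> (4 + 4) + (4 + 4)"
      by (intro add_mono sq) (use bounds in auto)
    finally show ?thesis by simp
  qed
  show ?thesis
  proof (cases "x = 0 \<or> y = 0")
    case True
    then show ?thesis
      using ip_scaleR_left[of 0 x y] ip_scaleR_right[of x 0 y] by auto
  next
    case False
    then have "norm (ip (x /\<^sub>R norm x) (y /\<^sub>R norm y)) \<le> 4"
      by (intro unit) auto
    then show ?thesis
      using False by (simp add: ip_scaleR_left ip_scaleR_right field_simps)
  qed
qed

lemma bounded_bilinear_ip: "bounded_bilinear ip"
  by unfold_locales (auto simp: ip_add_left ip_add_right ip_scaleR_left ip_scaleR_right intro: norm_ip_le)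

interpretation ip: bounded_bilinear ip
  by (rule bounded_bilinear_ip)

lemma ip_cancel: "(\<And>z. ip z x = ip z y) \<Longrightarrow> x = y"
  using ip_definite[of "x - y"] by (simp add: ip.diff_right)

lemma ip_cancel_left: "(\<And>z. ip x z = ip y z) \<Longrightarrow> x = y"
  using ip_definite[of "x - y"] by (simp add: ip.diff_left)

text \<open>
  This is the uniform boundedness principle for the functionals \<open>x \<mapsto> ip z (T x) = ip (S z) x\<close> with
  \<open>\<parallel>z\<parallel> \<le> 1\<close>: each of them is continuous because \<open>S\<close> is an adjoint of \<open>T\<close>, and they are
  pointwise bounded by \<open>4 \<parallel>T x\<parallel>\<close>.
\<close>

lemma adjointable_bounded_linear:
  assumes "adjointable T"
  shows "bounded_linear T"
proof -
  obtain S where S: "ip (T x) y = ip x (S y)" for x y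
    using assms unfolding adjointable_def by blast
  have S': "ip (S y) x = ip y (T x)" for x y
    by (metis S ip_star)
  have add: "T (x + y) = T x + T y" for x y
    by (rule ip_cancel) (simp add: ip.add_right flip: S')
  have scale: "T (r *\<^sub>R x) = r *\<^sub>R T x" for r x
    by (rule ip_cancel) (simp add: ip.scaleR_right flip: S')
  \<comment> \<open>By Baire's theorem one of these closed sets contains a ball, on which \<^term>\<open>T\<close> is bounded.\<close>
  define E where "E n = {x. \<forall>z. norm z \<le> 1 \<longrightarrow> norm (ip z (T x)) \<le> real n}" for n
  have E_closed: "closed (E n)" for n
    unfolding E_def S'[symmetric] imp_conv_disj
    by (intro closed_Collect_all closed_Collect_disj closed_Collect_const closed_Collect_le
        continuous_intros ip.continuous_on)
  have E_cover: "\<exists>n. x \<in> E n" for x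
  proof -
    obtain n where n: "4 * norm (T x) \<le> real n" using real_arch_simple by blast
    have "norm (ip z (T x)) \<le> real n" if "norm z \<le> 1" for z
      using norm_ip_le[of z "T x"] mult_right_mono[OF that, of "norm (T x)"] n by simp
    then show ?thesis by (auto simp: E_def)
  qed
  have "\<exists>n. interior (E n) \<noteq> {}"
  proof (rule ccontr)
    assume "\<nexists>n. interior (E n) \<noteq> {}"
    then have "euclidean interior_of \<Union>(range E) = {}"
      by (intro Baire_category_alt) (use E_closed in \<open>auto simp: completely_metrizable_space_euclidean\<close>)
    moreover have "\<Union>(range E) = UNIV" using E_cover by auto
    ultimately show False by simp
  qed
  then obtain n x0 r where r: "r > 0" "ball x0 r \<subseteq> E n"
    by (meson all_not_in_conv mem_interior)
  have small: "norm (T y) \<le> 2 * real n" if "norm y < r" for y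
  proof (cases "T y = 0")
    case False
    let ?z = "T y /\<^sub>R norm (T y)"
    have "norm ?z \<le> 1" using False by simp
    moreover have "x0 + y \<in> E n" "x0 \<in> E n"
      using r that by (auto simp: dist_norm subset_iff)
    ultimately have "norm (ip ?z (T (x0 + y)) - ip ?z (T x0)) \<le> real n + real n"
      unfolding E_def by (intro order_trans[OF norm_triangle_ineq4] add_mono) auto
    then have "norm (ip ?z (T y)) \<le> 2 * real n" by (simp add: add ip.add_right)
    then show ?thesis
      using False by (simp add: ip.scaleR_left power2_eq_square field_simps flip: ip_norm)
  qed auto
  show ?thesis
  proof (rule bounded_linear_intro)
    show "norm (T x) \<le> norm x * (4 * real n / r)" for x
    proof (cases "x = 0")
      case False
      define c where "c = r / (2 * norm x)"
      have c: "c > 0" using False r by (simp add: c_def)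
      have "norm (T (c *\<^sub>R x)) \<le> 2 * real n"
        by (rule small) (use False r in \<open>simp add: c_def\<close>)
      then have "c * norm (T x) \<le> 2 * real n" using c by (simp add: scale)
      then show ?thesis using False r by (simp add: c_def field_simps)
    qed (use scale[of 0 0] in simp)
  qed (fact add scale)+
qed

section \<open>Positive operators\<close>

text \<open>
  Only some bounded operators have an adjoint. A relation avoids an adjoint operation that is
  meaningful on a part of the type only.
\<close>

definition adjoint_pair :: "'h endo \<Rightarrow> 'h endo \<Rightarrow> bool"
  where "adjoint_pair a b \<longleftrightarrow> (\<forall>x y. ip (app a x) y = ip x (app b y))"

abbreviation selfadj :: "'h endo \<Rightarrow> bool"
  where "selfadj a \<equiv> adjoint_pair a a"

text \<open>
  Squares of self-adjoint operators, a condition that is formally stronger than being of the form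
  \<open>a\<^sup>*a\<close>. It is the one for which the cone properties and the existence of roots can be
  shown directly; the two notions are proved equal in \<open>psd_adjoint_mult\<close>.
\<close>

definition psd :: "'h endo \<Rightarrow> bool"
  where "psd p \<longleftrightarrow> (\<exists>a. selfadj a \<and> p = a * a)"

lemma adjoint_pair_sym: "adjoint_pair a b \<Longrightarrow> adjoint_pair b a"
  unfolding adjoint_pair_def by (metis ip_star)

lemma adjoint_pair_mult: "adjoint_pair a a' \<Longrightarrow> adjoint_pair b b' \<Longrightarrow> adjoint_pair (a * b) (b' * a')"
  unfolding adjoint_pair_def by simp

lemma selfadj_mult: "selfadj a \<Longrightarrow> selfadj b \<Longrightarrow> a * b = b * a \<Longrightarrow> selfadj (a * b)"
  using adjoint_pair_mult[of a a b b] by simp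

lemma adjoint_pair_one: "adjoint_pair 1 1" and adjoint_pair_zero: "adjoint_pair 0 0"
  by (simp_all add: adjoint_pair_def ip.zero_left ip.zero_right)

lemma adjoint_pair_add: "adjoint_pair a a' \<Longrightarrow> adjoint_pair b b' \<Longrightarrow> adjoint_pair (a + b) (a' + b')"
  and adjoint_pair_diff: "adjoint_pair a a' \<Longrightarrow> adjoint_pair b b' \<Longrightarrow> adjoint_pair (a - b) (a' - b')"
  and adjoint_pair_minus: "adjoint_pair a a' \<Longrightarrow> adjoint_pair (- a) (- a')"
  and adjoint_pair_scaleR: "adjoint_pair a a' \<Longrightarrow> adjoint_pair (r *\<^sub>R a) (r *\<^sub>R a')"
  by (simp_all add: adjoint_pair_def ip.add_left ip.add_right ip.diff_left ip.diff_right
      ip.minus_left ip.minus_right ip.scaleR_left ip.scaleR_right)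

lemmas adjoint_pair_intros = adjoint_pair_one adjoint_pair_zero adjoint_pair_add
  adjoint_pair_diff adjoint_pair_minus adjoint_pair_scaleR

lemma closed_selfadj: "closed {a. selfadj a}"
  unfolding adjoint_pair_def
  by (intro closed_Collect_all closed_Collect_eq continuous_intros ip.continuous_on
      linear_continuous_on bounded_linear_app_left)

lemma adjoint_pair_scaleC:
  assumes "adjoint_pair a b"
  shows "app a (z *\<^sub>C x) = z *\<^sub>C app a x"
  by (rule ip_cancel_left) (use assms in \<open>simp add: adjoint_pair_def ip_scaleC_left\<close>)

lemma selfadj_square_eq_0:
  assumes "selfadj a" "a * a = 0"
  shows "a = 0"
proof (rule endo_eqI)
  fix x
  have "ip (app a x) (app a x) = ip x (app (a * a) x)"
    using assms(1) by (simp add: adjoint_pair_def)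
  then show "app a x = app 0 x"
    using assms(2) ip_definite by (simp add: ip.zero_right)
qed

text \<open>
  The cross terms of \<open>\<langle>(a \<plusminus> ib) z, (a \<plusminus> ib) z\<rangle>\<close> cancel because \<open>a\<close> and \<open>b\<close> commute, so \<open>a + ib\<close> and \<open>a - ib\<close>
  are isometric, and \<open>a\<close> is their mean. All later norm estimates come from here.
\<close>

lemma sum_squares_one_contraction:
  assumes a: "selfadj a" and b: "selfadj b" and comm: "a * b = b * a" and one: "a * a + b * b = 1"
  shows "norm a \<le> 1"
proof (rule norm_endo_bound)
  fix z
  define u v where "u = app a z" and "v = \<i> *\<^sub>C app b z"
  have ab: "app a (app b z) = app b (app a z)"
    using arg_cong[OF comm, of "\<lambda>c. app c z"] by simp
  have zz: "app a (app a z) + app b (app b z) = z"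
    using arg_cong[OF one, of "\<lambda>c. app c z"] by simp
  have "ip u v + ip v u = 0"
    using a b ab by (simp add: u_def v_def adjoint_pair_def ip_scaleC_left ip_scaleC_right scaleC_zero flip: scaleC_add_left)
  moreover have "ip u u + ip v v = ip z z"
  proof -
    have "ip u u + ip v v = ip z (app a (app a z) + app b (app b z))"
      using a b by (simp add: u_def v_def adjoint_pair_def ip_scaleC_left ip_scaleC_right scaleC_scaleC ip.add_right
          scaleC_one)
    then show ?thesis by (simp add: zz)
  qed
  ultimately have "ip (u + v) (u + v) = ip z z" "ip (u - v) (u - v) = ip z z"
    by (simp_all add: ip.add_left ip.add_right ip.diff_left ip.diff_right algebra_simps)
      (metis add.assoc add.commute add_0)
  then have "norm (u + v) = norm z" "norm (u - v) = norm z"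
    by (simp_all add: norm_ip)
  moreover have "u + u = (u + v) + (u - v)" by simp
  then have "2 * norm u \<le> norm (u + v) + norm (u - v)"
    using norm_triangle_ineq[of "u + v" "u - v"] by (metis norm_scaleR scaleR_2 abs_numeral)
  ultimately show "norm (app a z) \<le> 1 * norm z" by (simp add: u_def)
qed simp

lemma root_one_minus:
  assumes x: "selfadj x" "norm x \<le> 1"
  obtains c where "selfadj c" "c * c = 1 - x" "norm (1 - c) \<le> 1" "\<And>d. d * x = x * d \<Longrightarrow> d * c = c * d"
proof -
  obtain y where y: "norm y \<le> 1" "(1 - y) * (1 - y) = 1 - x"
    and inv: "\<And>C. closed C \<Longrightarrow> 0 \<in> C \<Longrightarrow> (\<And>z. z \<in> C \<Longrightarrow> (1/2) *\<^sub>R (x + z * z) \<in> C) \<Longrightarrow> y \<in> C"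
    using square_root_one_minus[OF x(2)] by blast
  have "y \<in> {a. selfadj a}"
    by (rule inv) (auto intro: closed_selfadj adjoint_pair_intros selfadj_mult x)
  moreover have "y \<in> {z. d * z = z * d}" if d: "d * x = x * d" for d
  proof (rule inv)
    show "closed {z. d * z = z * d}"
      by (intro closed_Collect_eq continuous_intros)
    show "(1/2) *\<^sub>R (x + z * z) \<in> {z. d * z = z * d}" if "z \<in> {z. d * z = z * d}" for z
    proof -
      have "d * z = z * d" using that by simp
      then have "d * (z * z) = z * z * d" by (metis mult.assoc)
      then show ?thesis using d by (simp add: algebra_simps)
    qed
  qed simp
  ultimately have sa: "selfadj (1 - y)" and comm: "\<And>d. d * x = x * d \<Longrightarrow> d * y = y * d"
    by (simp_all add: adjoint_pair_diff adjoint_pair_one)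
  have comm': "d * (1 - y) = (1 - y) * d" if "d * x = x * d" for d
    using comm[OF that] by (simp add: algebra_simps)
  show thesis
    by (rule that[OF sa y(2) _ comm']) (use y(1) in simp)
qed

text \<open>
  With \<open>b\<close> a square root of \<open>1 - a\<^sup>2\<close>, the pair \<open>b\<close>, \<open>a\<close> satisfies \<open>b\<^sup>2 + a\<^sup>2 = 1\<close>, hence \<open>\<parallel>b\<parallel> \<le> 1\<close>.
\<close>

lemma one_minus_square_contraction:
  assumes a: "selfadj a" "norm a \<le> 1"
  shows "norm (1 - a * a) \<le> 1"
proof -
  have "norm (a * a) \<le> 1"
    using norm_mult_ineq[of a a] mult_le_one[OF a(2) _ a(2)] by simp
  then obtain b where b: "selfadj b" "b * b = 1 - a * a" "a * b = b * a"
    using root_one_minus[of "a * a"] selfadj_mult[of a a] a by (metis mult.assoc)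
  have "norm b \<le> 1"
    by (rule sum_squares_one_contraction[of b a]) (use a b in auto)
  then show ?thesis
    using norm_mult_ineq[of b b] mult_le_one[of "norm b" "norm b"] by (simp flip: b(2))
qed

lemma psd_selfadj: "psd p \<Longrightarrow> selfadj p"
  unfolding psd_def using selfadj_mult by blast

lemma psd_square: "selfadj a \<Longrightarrow> psd (a * a)"
  unfolding psd_def by blast

lemma psd_scaleR:
  assumes "psd p" "0 \<le> r"
  shows "psd (r *\<^sub>R p)"
proof -
  obtain a where "selfadj a" "p = a * a" using assms(1) psd_def by blast
  then show ?thesis
    using psd_square[of "sqrt r *\<^sub>R a"] adjoint_pair_scaleR assms(2) by simp
qed

text \<open>
  Self-adjoint operators at distance at most \<open>1\<close> from \<open>1\<close> are those with spectrum in \<open>[0, 2]\<close>.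
  Their roots can be chosen in the same ball, so roots can be taken repeatedly.
\<close>

lemma root_near_one:
  assumes "selfadj p" "norm (1 - p) \<le> 1"
  obtains c where "selfadj c" "c * c = p" "norm (1 - c) \<le> 1" "\<And>d. d * p = p * d \<Longrightarrow> d * c = c * d"
proof -
  obtain c where c: "selfadj c" "c * c = 1 - (1 - p)" "norm (1 - c) \<le> 1"
     "\<And>d. d * (1 - p) = (1 - p) * d \<Longrightarrow> d * c = c * d"
    using root_one_minus[of "1 - p"] assms by (metis adjoint_pair_diff adjoint_pair_one)
  have comm: "d * c = c * d" if "d * p = p * d" for d
    by (rule c(4)) (simp add: algebra_simps that)
  show thesis
    by (rule that[OF c(1) _ c(3) comm]) (use c(2) in simp)
qed

text \<open>
  Together with \<open>root_near_one\<close>, this characterises positive operators up to scaling by a norm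
  condition, which unlike being a square is visibly convex.
\<close>

lemma scaled_psd_near_one:
  assumes "psd p"
  obtains t where "t > 0" "\<And>s. s \<ge> t \<Longrightarrow> norm (1 - (1/s) *\<^sub>R p) \<le> 1"
proof -
  obtain a where a: "selfadj a" "p = a * a" using assms psd_def by blast
  define t where "t = (norm a)\<^sup>2 + 1"
  have t: "t > 0" by (simp add: t_def add_nonneg_pos)
  have "norm (1 - (1/s) *\<^sub>R p) \<le> 1" if "s \<ge> t" for s
  proof -
    have s: "s > 0" using t that by simp
    have "norm a \<le> sqrt s" using that by (intro real_le_rsqrt) (simp add: t_def)
    then have "norm ((1 / sqrt s) *\<^sub>R a) \<le> 1" using s by (simp add: field_simps)
    from one_minus_square_contraction[OF adjoint_pair_scaleR[OF a(1)] this]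
    show ?thesis using s by (simp add: a(2))
  qed
  with t show thesis by (rule that)
qed

text \<open>
  After scaling, \<open>p\<close> lies in the unit ball around \<open>1\<close>. So does its root, which therefore is a square
  itself.
\<close>

lemma psd_root:
  assumes "psd p"
  obtains c where "psd c" "c * c = p" "\<And>d. d * p = p * d \<Longrightarrow> d * c = c * d"
proof -
  obtain s where s: "s > 0" "norm (1 - (1/s) *\<^sub>R p) \<le> 1"
    using scaled_psd_near_one[OF assms] by blast
  obtain c where c: "selfadj c" "c * c = (1/s) *\<^sub>R p" "norm (1 - c) \<le> 1"
      "\<And>d. d * (1/s) *\<^sub>R p = (1/s) *\<^sub>R p * d \<Longrightarrow> d * c = c * d"
    using root_near_one[OF adjoint_pair_scaleR[OF psd_selfadj[OF assms]] s(2)] by blast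
  have "psd c" using root_near_one[OF c(1,3)] psd_square by metis
  then have "psd (sqrt s *\<^sub>R c)" using s by (simp add: psd_scaleR)
  moreover have "sqrt s *\<^sub>R c * sqrt s *\<^sub>R c = p" using s by (simp add: c(2))
  moreover have "d * sqrt s *\<^sub>R c = sqrt s *\<^sub>R c * d" if "d * p = p * d" for d
    using c(4)[of d] that by simp
  ultimately show thesis by (rule that)
qed

lemma psd_add:
  assumes "psd p" "psd q"
  shows "psd (p + q)"
proof -
  obtain t u where t: "t > 0" "\<And>s. s \<ge> t \<Longrightarrow> norm (1 - (1/s) *\<^sub>R p) \<le> 1"
    and u: "u > 0" "\<And>s. s \<ge> u \<Longrightarrow> norm (1 - (1/s) *\<^sub>R q) \<le> 1"
    using scaled_psd_near_one assms by metis
  define s where "s = max t u"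
  let ?r = "(1 / (2 * s)) *\<^sub>R (p + q)"
  have s: "s > 0" "norm (1 - (1/s) *\<^sub>R p) \<le> 1" "norm (1 - (1/s) *\<^sub>R q) \<le> 1"
    using t u by (auto simp: s_def)
  have "2 *\<^sub>R (1 - ?r) = (1 - (1/s) *\<^sub>R p) + (1 - (1/s) *\<^sub>R q)"
    by (simp add: algebra_simps scaleR_2)
  then have "norm (2 *\<^sub>R (1 - ?r)) \<le> 1 + 1"
    using norm_triangle_ineq order_trans add_mono[OF s(2,3)] by metis
  then have "norm (1 - ?r) \<le> 1" by simp
  moreover have "selfadj ?r" using assms psd_selfadj by (intro adjoint_pair_intros) auto
  ultimately have "psd ?r" using root_near_one psd_square by metis
  then have "psd ((2 * s) *\<^sub>R ?r)" by (rule psd_scaleR) (use s in simp)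
  then show ?thesis using s by simp
qed

lemma psd_mult:
  assumes "psd p" "psd q" "p * q = q * p"
  shows "psd (p * q)"
proof -
  obtain c where c: "psd c" "c * c = p" "\<And>d. d * p = p * d \<Longrightarrow> d * c = c * d"
    using psd_root[OF assms(1)] by blast
  obtain e where e: "psd e" "e * e = q" "\<And>d. d * q = q * d \<Longrightarrow> d * e = e * d"
    using psd_root[OF assms(2)] by blast
  have "c * e = e * c" using c(3) e(3) assms(3) by metis
  then show ?thesis
    using psd_square[OF selfadj_mult[OF psd_selfadj[OF c(1)] psd_selfadj[OF e(1)]]]
    by (metis c(2) e(2) mult.assoc)
qed

text \<open>
  For \<open>r > 0\<close> the operator \<open>r - p\<close> is positive, so \<open>r = e\<^sup>2 + f\<^sup>2\<close> with \<open>e\<^sup>2 = p\<close> and \<open>f\<^sup>2 = r - p\<close>. By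
  \<open>sum_squares_one_contraction\<close>, \<open>\<parallel>p\<parallel> \<le> r\<close>.
\<close>

lemma psd_pointed:
  assumes p: "psd p" and np: "psd (- p)"
  shows "p = 0"
proof -
  have bound: "norm p \<le> r" if r: "r > 0" for r
  proof -
    have "psd (r *\<^sub>R 1 + - p)"
      using psd_square[OF adjoint_pair_one] r by (intro psd_add psd_scaleR np) auto
    then obtain f where f: "psd f" "f * f = r *\<^sub>R 1 - p"
        "\<And>d. d * (r *\<^sub>R 1 - p) = (r *\<^sub>R 1 - p) * d \<Longrightarrow> d * f = f * d"
      by (metis psd_root diff_conv_add_uminus)
    obtain e where e: "psd e" "e * e = p" "\<And>d. d * p = p * d \<Longrightarrow> d * e = e * d"
      using psd_root[OF p] by blast
    have "p * f = f * p" by (rule f(3)) (simp add: algebra_simps)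
    then have ef: "e * f = f * e" using e(3)[of f] by simp
    have "norm ((1 / sqrt r) *\<^sub>R e) \<le> 1"
    proof (rule sum_squares_one_contraction)
      show "selfadj ((1 / sqrt r) *\<^sub>R e)" "selfadj ((1 / sqrt r) *\<^sub>R f)"
        using e(1) f(1) psd_selfadj adjoint_pair_scaleR by auto
      show "(1 / sqrt r) *\<^sub>R e * (1 / sqrt r) *\<^sub>R e + (1 / sqrt r) *\<^sub>R f * (1 / sqrt r) *\<^sub>R f = 1"
        using r by (simp add: e(2) f(2) algebra_simps)
    qed (use ef in simp)
    then have "norm e \<le> sqrt r" using r by (simp add: field_simps)
    then have "norm e * norm e \<le> r" using mult_mono[of "norm e" "sqrt r" "norm e" "sqrt r"] r by simp
    then show "norm p \<le> r" using norm_mult_ineq[of e e] e(2) by simp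
  qed
  have "\<not> 0 < norm p"
    using bound[of "norm p / 2"] by linarith
  then show ?thesis by simp
qed

text \<open>
  For \<open>d = p - q\<close>, the positive operators \<open>dpd\<close> and \<open>dqd\<close> have sum \<open>d(p\<^sup>2 - q\<^sup>2) = 0\<close>, so both vanish and
  \<open>d\<^sup>3 = dpd - dqd = 0\<close>.
\<close>

lemma psd_root_unique:
  assumes p: "psd p" and q: "psd q" and comm: "p * q = q * p" and sq: "p * p = q * q"
  shows "p = q"
proof -
  define d where "d = p - q"
  have d: "selfadj d" "d * p = p * d" "d * q = q * d"
    using p q psd_selfadj comm by (auto simp: d_def algebra_simps intro: adjoint_pair_diff)
  have conj: "psd (d * r * d)" if r: "psd r" "d * r = r * d" for r
    using psd_mult[OF r(1) psd_square[OF d(1)]] r(2) by (metis mult.assoc)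
  have "d * p * d + d * q * d = d * ((p + q) * (p - q))"
    by (simp add: d_def algebra_simps)
  also have "(p + q) * (p - q) = 0"
    using comm sq by (simp add: algebra_simps)
  finally have "d * q * d = - (d * p * d)" by (simp add: eq_neg_iff_add_eq_0 add.commute)
  then have "d * p * d = 0" "d * q * d = 0"
    using psd_pointed[of "d * p * d"] conj[OF p d(2)] conj[OF q d(3)] by auto
  then have "d * (p - q) * d = 0" by (simp add: algebra_simps)
  then have "d * d * d = 0" by (simp flip: d_def)
  then have "(d * d) * (d * d) = 0" by (simp add: mult.assoc[symmetric])
  then show ?thesis
    using selfadj_square_eq_0 d(1) selfadj_mult by (metis d_def right_minus_eq)
qed

text \<open>
  With real and imaginary parts \<open>u\<close>, \<open>v\<close> of \<open>y\<close>, the operator in question is \<open>2u\<^sup>2 + 2v\<^sup>2\<close>. In the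
  proof \<open>s = 2u\<close> and \<open>d = 2iv\<close>.
\<close>

lemma psd_symmetrized:
  assumes "adjoint_pair y y'"
  shows "psd (y' * y + y * y')"
proof -
  have "bounded_linear (\<lambda>x::'h. \<i> *\<^sub>C x)"
    by (rule bounded_linear_intro[where K = 1])
      (simp_all add: scaleC_add_right scaleR_scaleC scaleC_scaleC norm_scaleC mult.commute)
  \<comment> \<open>Multiplication by \<open>\<i>\<close> as an operator turns the skew-adjoint \<open>d\<close> into the self-adjoint \<open>J * d\<close>.\<close>
  then obtain J :: "'h endo" where "app J = (\<lambda>x. \<i> *\<^sub>C x)"
    by (rule bounded_linear_endo)
  then have J: "app J x = \<i> *\<^sub>C x" for x by simp
  define s d where "s = y + y'" and "d = y - y'"
  have s: "selfadj s"
    using adjoint_pair_add[OF assms adjoint_pair_sym[OF assms]] by (simp add: s_def add.commute)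
  have d: "adjoint_pair d (- d)"
    using adjoint_pair_diff[OF assms adjoint_pair_sym[OF assms]] by (simp add: d_def)
  have "selfadj (J * d)"
    unfolding adjoint_pair_def
  proof (intro allI)
    fix x z
    have "ip (app (J * d) x) z = - (\<i> *\<^sub>C ip (app d x) z)"
      by (simp add: J ip_scaleC_left scaleC_minus_left)
    also have "ip (app d x) z = - ip x (app d z)"
      using d by (simp add: adjoint_pair_def ip.minus_right)
    finally show "ip (app (J * d) x) z = ip x (app (J * d) z)"
      by (simp add: J ip_scaleC_right scaleC_minus_right)
  qed
  moreover have "J * d * (J * d) = - (d * d)"
  proof (rule endo_eqI)
    fix x
    show "app (J * d * (J * d)) x = app (- (d * d)) x"
      by (simp add: J adjoint_pair_scaleC[OF d] scaleC_scaleC scaleC_minus1 scaleC_minus_left scaleC_one)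
  qed
  ultimately have "psd (- (d * d))"
    using psd_square[of "J * d"] by simp
  then have "psd ((1/2) *\<^sub>R (s * s + - (d * d)))"
    by (intro psd_scaleR psd_add psd_square s) auto
  moreover have "s * s + - (d * d) = 2 *\<^sub>R (y' * y + y * y')"
    by (simp add: s_def d_def algebra_simps scaleR_2)
  ultimately show ?thesis by simp
qed

text \<open>
  Here \<open>k = |h|\<close>, and \<open>m = (k - h) / 2\<close> is the negative part of \<open>h\<close>. To see that it is positive, compare
  it with the positive root \<open>g\<close> of \<open>m\<^sup>2\<close>. As \<open>km = m\<^sup>2\<close>, both \<open>kg\<close> and \<open>g\<^sup>2\<close> are positive roots of \<open>g\<^sup>4\<close>, so they
  agree, and \<open>k(g - m) = 0\<close>. Since the squares of \<open>g\<close> and \<open>m\<close> are multiples of \<open>k\<close>, also \<open>g\<close> and \<open>m\<close>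
  annihilate \<open>g - m\<close>, whose square is therefore \<open>0\<close>.
\<close>

lemma psd_negative_part:
  assumes h: "selfadj h" and k: "psd k" and kk: "k * k = h * h" and kh: "k * h = h * k"
  shows "psd ((1/2) *\<^sub>R (k - h))"
proof -
  define m where "m = (1/2) *\<^sub>R (k - h)"
  have m: "selfadj m" using h k psd_selfadj by (auto simp: m_def intro: adjoint_pair_intros)
  have km: "k * m = m * m" and mk: "m * k = m * m"
    by (simp_all add: m_def algebra_simps kk kh flip: scaleR_2)
  obtain g where g: "psd g" "g * g = m * m" and g_comm: "\<And>d. d * (m * m) = m * m * d \<Longrightarrow> d * g = g * d"
    using psd_root[OF psd_square[OF m]] by blast
  have gm: "m * g = g * m" by (rule g_comm) (simp add: mult.assoc)
  have gk: "k * g = g * k" by (rule g_comm) (metis km mk mult.assoc)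
  have "k * g = g * g"
  proof (rule psd_root_unique)
    show "psd (k * g)" by (rule psd_mult[OF k g(1) gk])
    show "psd (g * g)" by (rule psd_square[OF psd_selfadj[OF g(1)]])
    show "k * g * (g * g) = g * g * (k * g)" by (metis gk mult.assoc)
    have "k * g * (k * g) = k * k * (g * g)" by (metis gk mult.assoc)
    also have "\<dots> = k * (k * m) * m" by (simp add: g(2) mult.assoc)
    also have "\<dots> = g * g * (g * g)" by (simp add: g(2) km) (metis km mult.assoc)
    finally show "k * g * (k * g) = g * g * (g * g)" .
  qed
  then have kgm: "k * g = k * m" by (simp add: km g(2))
  \<comment> \<open>Applied to \<open>z = g\<close> and \<open>z = m\<close>, whose common square is \<open>m * k\<close>.\<close>
  have z0: "z * (g - m) = 0" if z: "selfadj z" "z * g = g * z" "z * m = m * z" "z * z = m * m" for z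
  proof (rule selfadj_square_eq_0)
    have comm: "z * (g - m) = (g - m) * z" by (simp add: algebra_simps z)
    show "selfadj (z * (g - m))"
      by (rule selfadj_mult[OF z(1) adjoint_pair_diff[OF psd_selfadj[OF g(1)] m] comm])
    have "z * (g - m) * (z * (g - m)) = z * (z * (g - m)) * (g - m)"
      unfolding comm by (metis comm mult.assoc)
    also have "z * (z * (g - m)) = m * (k * (g - m))"
      by (metis z(4) mk mult.assoc)
    also have "k * (g - m) = 0" by (simp add: algebra_simps kgm)
    finally show "z * (g - m) * (z * (g - m)) = 0" by simp
  qed
  have "g * (g - m) = 0" "m * (g - m) = 0"
    using z0[of g] z0[of m] g gm m psd_selfadj by auto
  then have "(g - m) * (g - m) = 0" by (simp only: left_diff_distrib[of g m] diff_self)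
  then have "g - m = 0"
    using selfadj_square_eq_0[OF adjoint_pair_diff[OF psd_selfadj[OF g(1)] m]] by simp
  then show ?thesis using g(1) by (simp add: m_def)
qed

text \<open>
  Let \<open>m\<close> be the negative part of \<open>h = a\<^sup>*a\<close>. Then \<open>x = am\<close> satisfies \<open>x\<^sup>*x = -m\<^sup>3\<close>, and the aim is to
  show that this forces \<open>m = 0\<close>. The usual proof compares the spectra of \<open>x\<^sup>*x\<close> and \<open>xx\<^sup>*\<close>. Instead,
  put \<open>p = m\<^sup>3\<close> and \<open>y = xr\<close> with \<open>r\<^sup>2 = p\<close>: both \<open>y\<^sup>*y = -p\<^sup>2\<close> and \<open>yy\<^sup>* = -(xx\<^sup>*)\<^sup>2\<close> are negative,
  while their sum is positive by \<open>psd_symmetrized\<close>. So they vanish.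
\<close>

lemma psd_adjoint_mult:
  assumes a: "adjoint_pair a a'"
  shows "psd (a' * a)"
proof -
  define h where "h = a' * a"
  have h: "selfadj h" unfolding h_def by (rule adjoint_pair_mult[OF adjoint_pair_sym[OF a] a])
  obtain k where k: "psd k" "k * k = h * h" and k_comm: "\<And>d. d * (h * h) = h * h * d \<Longrightarrow> d * k = k * d"
    using psd_root[OF psd_square[OF h]] by blast
  have kh: "k * h = h * k" using k_comm[of h] by (simp add: mult.assoc)
  define m where "m = (1/2) *\<^sub>R (k - h)"
  have m: "psd m" unfolding m_def by (rule psd_negative_part[OF h k kh])
  have hm: "m * h = - (m * m)"
    by (simp add: m_def algebra_simps k(2) kh flip: scaleR_2)
  obtain c where c: "psd c" "c * c = m" using psd_root[OF m] by blast
  note sa = psd_selfadj[OF m] psd_selfadj[OF c(1)]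
  have cm: "c * m = m * c" by (metis c(2) mult.assoc)
  define r where "r = m * c"
  have r: "selfadj r" unfolding r_def by (rule selfadj_mult[OF sa]) (simp add: cm)
  define p where "p = m * m * m"
  have rr: "r * r = p" unfolding r_def p_def by (metis c(2) cm mult.assoc)
  have p: "selfadj p" using selfadj_mult[OF r r] rr by simp
  define x x' where "x = a * m" and "x' = m * a'"
  have x: "adjoint_pair x x'" unfolding x_def x'_def by (rule adjoint_pair_mult[OF a sa(1)])
  have x'x: "x' * x = - p"
  proof -
    have "x' * x = m * h * m" by (simp add: x_def x'_def h_def mult.assoc)
    then show ?thesis by (simp add: hm p_def)
  qed
  define w where "w = x * x'"
  have w: "selfadj w" unfolding w_def by (rule adjoint_pair_mult[OF x adjoint_pair_sym[OF x]])
  have "r * x' * (x * r) = r * (x' * x) * r" by (simp add: mult.assoc)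
  also have "\<dots> = - (p * p)" by (simp add: x'x) (metis rr mult.assoc)
  finally have 1: "r * x' * (x * r) = - (p * p)" .
  have "x * r * (r * x') = x * p * x'" by (metis rr mult.assoc)
  also have "\<dots> = - (x * (x' * x) * x')" by (simp add: x'x)
  also have "\<dots> = - (w * w)" by (simp add: w_def mult.assoc)
  finally have 2: "x * r * (r * x') = - (w * w)" .
  have "psd (- (p * p) + - (w * w))"
    using psd_symmetrized[OF adjoint_pair_mult[OF x r]] 1 2 by simp
  then have "psd (- (p * p))"
    using psd_add[OF _ psd_square[OF w]] by fastforce
  then have "p * p = 0" using psd_pointed[OF psd_square[OF p]] by simp
  then have "p = 0" by (rule selfadj_square_eq_0[OF p])
  then have "m * m * (m * m) = 0" by (simp add: p_def flip: mult.assoc)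
  then have "m = 0" using selfadj_square_eq_0 selfadj_mult sa(1) by metis
  then have "h = k" by (simp add: m_def)
  then show ?thesis using k(1) by (simp add: h_def)
qed

section \<open>Adjoints and absolute values of maps\<close>

lemma adj_eqI:
  assumes "\<And>x y. ip (T x) y = ip x (S y)"
  shows "adjointable T" "adj T = S"
proof -
  show "adjointable T" using assms by (auto simp: adjointable_def)
  show "adj T = S"
    unfolding adj_def
  proof (rule the_equality)
    fix R assume R: "\<forall>x y. ip (T x) y = ip x (R y)"
    show "R = S" by (intro ext ip_cancel) (use R assms in metis)
  qed (use assms in simp)
qed

lemma ip_adj: "adjointable T \<Longrightarrow> ip (T x) y = ip x (adj T y)"
  by (metis adj_eqI(2) adjointable_def)

lemma ip_adj_left: "adjointable T \<Longrightarrow> ip (adj T x) y = ip x (T y)"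
  by (metis ip_adj ip_star)

lemma adjointable_adj: "adjointable T \<Longrightarrow> adjointable (adj T)"
  and adj_adj: "adjointable T \<Longrightarrow> adj (adj T) = T"
  by (rule adj_eqI; simp add: ip_adj_left)+

lemma adjointable_comp: "adjointable S \<Longrightarrow> adjointable T \<Longrightarrow> adjointable (S \<circ> T)"
  and adj_comp: "adjointable S \<Longrightarrow> adjointable T \<Longrightarrow> adj (S \<circ> T) = adj T \<circ> adj S"
  by (rule adj_eqI; simp add: ip_adj)+

lemma adjointable_funpow: "adjointable T \<Longrightarrow> adjointable (T ^^ k)"
  by (induction k) (auto intro: adjointable_comp adj_eqI(1) simp: id_def)

lemmas adjointable_intros = adjointable_comp adjointable_adj adjointable_funpow

lemma adjointable_endo:
  assumes "adjointable T"
  obtains a a' where "app a = T" "app a' = adj T" "adjoint_pair a a'"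
proof -
  obtain a where a: "app a = T"
    using bounded_linear_endo[OF adjointable_bounded_linear[OF assms]] .
  obtain a' where a': "app a' = adj T"
    using bounded_linear_endo[OF adjointable_bounded_linear[OF adjointable_adj[OF assms]]] .
  show thesis
    by (rule that[OF a a']) (simp add: adjoint_pair_def a a' ip_adj assms)
qed

lemma adjoint_pair_app:
  assumes "adjoint_pair a a'"
  shows "adjointable (app a)" "adj (app a) = app a'"
  using assms by (auto intro: adj_eqI simp: adjoint_pair_def)

lemma app_mult: "app (a * b) = app a \<circ> app b"
  by auto

lemma app_inject: "app a = app b \<longleftrightarrow> a = b"
  by (metis endo_eqI)

lemma positive_op_iff_psd: "positive_op S \<longleftrightarrow> (\<exists>p. psd p \<and> app p = S)"
proof
  assume "positive_op S"
  then obtain R where R: "adjointable R" "S = adj R \<circ> R" by (auto simp: positive_op_def)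
  obtain a a' where "app a = R" "app a' = adj R" "adjoint_pair a a'" by (rule adjointable_endo[OF R(1)])
  then show "\<exists>p. psd p \<and> app p = S"
    using psd_adjoint_mult R(2) by (metis app_mult)
next
  assume "\<exists>p. psd p \<and> app p = S"
  then obtain a where "selfadj a" "app (a * a) = S" by (auto simp: psd_def)
  then show "positive_op S"
    unfolding positive_op_def by (intro exI[of _ "app a"]) (simp add: adjoint_pair_app app_mult)
qed

lemma positive_op_adjointable: "positive_op S \<Longrightarrow> adjointable S"
  and positive_op_adj: "positive_op S \<Longrightarrow> adj S = S"
  unfolding positive_op_def by (auto intro: adjointable_intros simp: adj_comp adj_adj adjointable_adj)

lemma positive_op_comp:
  assumes "positive_op A" "positive_op B" "A \<circ> B = B \<circ> A"
  shows "positive_op (A \<circ> B)"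
proof -
  obtain p q where "psd p" "app p = A" "psd q" "app q = B"
    using assms by (auto simp: positive_op_iff_psd)
  then show ?thesis
    using assms(3) psd_mult[of p q] by (auto simp: positive_op_iff_psd app_mult simp flip: app_inject)
qed

lemma positive_op_conj:
  assumes "positive_op A" "adjointable C"
  shows "positive_op (adj C \<circ> A \<circ> C)"
proof -
  obtain R where R: "adjointable R" "A = adj R \<circ> R" using assms by (auto simp: positive_op_def)
  then show ?thesis
    unfolding positive_op_def using assms(2)
    by (intro exI[of _ "R \<circ> C"]) (simp add: adjointable_comp adj_comp o_assoc)
qed

text \<open>
  The last fact, that \<open>|T|\<close> belongs to the bicommutant of \<open>T\<^sup>*T\<close>, also yields uniqueness: a positive
  root \<open>S\<close> of \<open>T\<^sup>*T\<close> commutes with \<open>S\<^sup>2\<close>, hence with any root in the bicommutant, and commuting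
  positive roots coincide.
\<close>

lemma
  assumes "adjointable T"
  shows positive_abs_op: "positive_op (abs_op T)"
    and abs_op_square: "abs_op T \<circ> abs_op T = adj T \<circ> T"
    and abs_op_unique: "\<And>S. positive_op S \<Longrightarrow> S \<circ> S = adj T \<circ> T \<Longrightarrow> S = abs_op T"
    and abs_op_commute: "\<And>C. adjointable C \<Longrightarrow> C \<circ> (adj T \<circ> T) = (adj T \<circ> T) \<circ> C
      \<Longrightarrow> C \<circ> abs_op T = abs_op T \<circ> C"
proof -
  obtain a a' where a: "app a = T" "app a' = adj T" "adjoint_pair a a'" by (rule adjointable_endo[OF assms])
  obtain c where c: "psd c" "c * c = a' * a"
    and comm: "\<And>d. d * (a' * a) = a' * a * d \<Longrightarrow> d * c = c * d"
    using psd_root[OF psd_adjoint_mult[OF a(3)]] by blast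
  have sq: "app c \<circ> app c = adj T \<circ> T" using c(2) a by (metis app_mult)
  have uniq: "S = app c" if S: "positive_op S" "S \<circ> S = adj T \<circ> T" for S
  proof -
    obtain p where p: "psd p" "app p = S" using S(1) positive_op_iff_psd by blast
    have pp: "p * p = a' * a" using S(2) p(2) a by (metis app_mult app_inject)
    then have "p * c = c * p" by (intro comm) (metis mult.assoc)
    then show "S = app c" using psd_root_unique[OF p(1) c(1)] pp c(2) p(2) by simp
  qed
  have c_pos: "positive_op (app c)" using c(1) positive_op_iff_psd by blast
  have abs: "abs_op T = app c"
    unfolding abs_op_def by (rule the_equality) (use c_pos sq in blast, use uniq in blast)
  show "positive_op (abs_op T)" "abs_op T \<circ> abs_op T = adj T \<circ> T"
    and "\<And>S. positive_op S \<Longrightarrow> S \<circ> S = adj T \<circ> T \<Longrightarrow> S = abs_op T"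
    unfolding abs by (fact c_pos, fact sq, fact uniq)
  show "C \<circ> abs_op T = abs_op T \<circ> C" if C: "adjointable C" "C \<circ> (adj T \<circ> T) = (adj T \<circ> T) \<circ> C" for C
  proof -
    obtain d d' where d: "app d = C" "app d' = adj C" "adjoint_pair d d'" by (rule adjointable_endo[OF C(1)])
    have "d * (a' * a) = a' * a * d" using C(2) a d by (metis app_mult app_inject)
    then show ?thesis using comm d(1) abs by (metis app_mult)
  qed
qed

section \<open>Projections and partial isometries\<close>

lemma adjointable_additive:
  assumes "adjointable T"
  shows "T (x + y) = T x + T y" "T (x - y) = T x - T y" "T (z *\<^sub>C x) = z *\<^sub>C T x"
    "T (x \<cdot> a) = T x \<cdot> a" "T 0 = 0"
proof -
  interpret bounded_linear T by (rule adjointable_bounded_linear[OF assms])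
  show "T (x + y) = T x + T y" "T (x - y) = T x - T y" "T 0 = 0" by (simp_all add: add diff zero)
  show "T (z *\<^sub>C x) = z *\<^sub>C T x"
    by (rule ip_cancel) (simp add: ip_scaleC_right assms flip: ip_adj_left)
  show "T (x \<cdot> a) = T x \<cdot> a"
    by (rule ip_cancel) (simp add: ip_act_right assms flip: ip_adj_left)
qed

lemma adjointable_continuous: "adjointable T \<Longrightarrow> continuous_on A T"
  by (simp add: adjointable_bounded_linear linear_continuous_on)

lemma projection_simps:
  assumes "projection P"
  shows "adjointable P" "adj P = P" "P (P x) = P x" "x \<in> range P \<longleftrightarrow> P x = x"
proof -
  show "adjointable P" "adj P = P" using assms by (auto simp: projection_def)
  show PP: "P (P x) = P x" for x using assms by (metis comp_apply projection_def)
  show "x \<in> range P \<longleftrightarrow> P x = x" using PP by (metis imageE rangeI)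
qed

lemma closed_range_projection:
  assumes "projection P"
  shows "closed (range P)"
proof -
  have "range P = {x. P x = x}" using projection_simps(4)[OF assms] by blast
  then show ?thesis
    using projection_simps(1)[OF assms]
    by (simp add: closed_Collect_eq adjointable_continuous)
qed

lemma orth_compl_diff: "x \<in> orth_compl M \<Longrightarrow> y \<in> orth_compl M \<Longrightarrow> x - y \<in> orth_compl M"
  by (simp add: orth_compl_def ip.diff_right)

lemma projection_range_complemented:
  assumes P: "projection P"
  shows "orth_complemented (range P)" "proj_onto (range P) = P"
proof -
  note P' = projection_simps[OF P] and lin = adjointable_additive[OF projection_simps(1)[OF P]]
  have perp: "x - P x \<in> orth_compl (range P)" for x
    by (auto simp: orth_compl_def ip_adj P' lin ip.zero_right)
  have triv: "m = 0" if "m \<in> range P" "m \<in> orth_compl (range P)" for m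
    using that ip_definite by (auto simp: orth_compl_def)
  have "submodule (range P)"
    unfolding submodule_def by (metis (no_types, lifting) P'(4) lin(1,3,4,5))
  moreover have "\<exists>x y. z = x + y \<and> x \<in> range P \<and> y \<in> orth_compl (range P)" for z
    using perp[of z] by (intro exI[of _ "P z"] exI[of _ "z - P z"]) auto
  moreover have "0 \<in> orth_compl (range P)" "0 \<in> range P"
    using P'(4) lin(5) by (auto simp: orth_compl_def ip.zero_right)
  ultimately show "orth_complemented (range P)"
    unfolding orth_complemented_def using triv closed_range_projection[OF P] by auto
  show "proj_onto (range P) = P"
  proof
    fix x
    show "proj_onto (range P) x = P x"
      unfolding proj_onto_def
    proof (rule the_equality)
      fix m assume m: "m \<in> range P \<and> x - m \<in> orth_compl (range P)"
      have "P x - m \<in> range P" using m P'(3,4) lin(2) by auto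
      moreover have "P x - m = (x - m) - (x - P x)" by simp
      then have "P x - m \<in> orth_compl (range P)"
        using m perp[of x] orth_compl_diff by metis
      ultimately have "P x - m = 0" by (rule triv)
      then show "m = P x" by simp
    qed (use perp in auto)
  qed
qed

lemma range_proj_onto:
  assumes M: "orth_complemented M"
  shows "range (proj_onto M) = M"
proof -
  have sub: "submodule M" and triv: "\<And>x. x \<in> M \<Longrightarrow> x \<in> orth_compl M \<Longrightarrow> x = 0"
    using M by (auto simp: orth_complemented_def)
  have minus: "x - y \<in> M" if "x \<in> M" "y \<in> M" for x y
    using sub that unfolding submodule_def by (metis diff_conv_add_uminus scaleC_minus1)
  have unique: "m = n" if "m \<in> M" "x - m \<in> orth_compl M" "n \<in> M" "x - n \<in> orth_compl M" for m n x
  proof -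
    have "m - n = (x - n) - (x - m)" by simp
    then have "m - n \<in> orth_compl M"
      using that(2,4) orth_compl_diff by metis
    then show ?thesis using triv[OF minus[OF that(1,3)]] by simp
  qed
  have eq: "proj_onto M x = m" if "m \<in> M" "x - m \<in> orth_compl M" for x m
    unfolding proj_onto_def using that unique by (intro the_equality) auto
  have "proj_onto M x \<in> M" for x
  proof -
    have "x \<in> {x + y |x y. x \<in> M \<and> y \<in> orth_compl M}"
      using M by (simp add: orth_complemented_def)
    then obtain m n where "x = m + n" "m \<in> M" "n \<in> orth_compl M" by blast
    then show ?thesis using eq[of m x] by simp
  qed
  moreover have "proj_onto M m = m" if "m \<in> M" for m
    using eq[OF that, of m] by (simp add: orth_compl_def ip.zero_right)
  ultimately show ?thesis by (metis image_subset_iff rangeI subsetI subset_antisym)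
qed

text \<open>
  The self-adjoint \<open>C\<close> maps the range of \<open>D\<close> to itself, hence also its closure and the orthogonal
  complement of the closure.
\<close>

lemma projection_commute:
  assumes C: "adjointable C" "adj C = C" and E: "projection E" "range E = closure (range D)"
    and CD: "C \<circ> D = D \<circ> C"
  shows "C \<circ> E = E \<circ> C"
proof -
  note E' = projection_simps[OF E(1)]
  have "C ` range D \<subseteq> closure (range D)"
    using fun_cong[OF CD] closure_subset by fastforce
  then have "C ` closure (range D) \<subseteq> closure (range D)"
    by (intro image_closure_subset adjointable_continuous C(1)) auto
  then have "E (C (E x)) = C (E x)" for x
    using E(2) E'(4) by blast
  then have ECE: "E \<circ> C \<circ> E = C \<circ> E" by auto
  moreover have "adj (E \<circ> C \<circ> E) = E \<circ> C \<circ> E" "adj (C \<circ> E) = E \<circ> C"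
    using C E'(1,2) by (simp_all add: adj_comp adjointable_comp o_assoc)
  ultimately show ?thesis by metis
qed

lemma partial_isometry_simps:
  assumes "partial_isometry U"
  shows "adjointable U" "U (adj U (U x)) = U x" "adj U (U (adj U x)) = adj U x"
    "projection (adj U \<circ> U)" "projection (U \<circ> adj U)"
proof -
  show U: "adjointable U" and P: "projection (adj U \<circ> U)"
    using assms by (auto simp: partial_isometry_def)
  have UU: "U (adj U (U x)) = U x" for x
  proof -
    \<comment> \<open>The projection \<open>U\<^sup>*U\<close> annihilates \<open>w\<close>, and \<open>\<langle>Uw, Uw\<rangle> = \<langle>w, U\<^sup>*Uw\<rangle>\<close>.\<close>
    define w where "w = x - adj U (U x)"
    have "adj U (U w) = 0"
      using projection_simps(3)[OF P, of x]
      by (simp add: w_def adjointable_additive U adjointable_adj)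
    then have "ip (U w) (U w) = 0" by (simp add: ip_adj U ip.zero_right)
    then have "U w = 0" by (rule ip_definite)
    then show ?thesis by (simp add: w_def adjointable_additive U)
  qed
  show "U (adj U (U x)) = U x" by (rule UU)
  have "adj (U \<circ> adj U \<circ> U) = adj U" using UU by (simp add: comp_def)
  then have "adj U \<circ> (U \<circ> adj U) = adj U"
    using U by (simp add: adj_comp adj_adj adjointable_intros)
  then show UU': "adj U (U (adj U x)) = adj U x" for x by (metis comp_apply)
  show "projection (U \<circ> adj U)"
    unfolding projection_def using U UU
    by (auto simp: adj_comp adj_adj adjointable_intros)
qed

section \<open>Polar decompositions\<close>

text \<open>
  If \<open>T = U|T|\<close>, then \<open>U\<^sup>*T = U\<^sup>*U|T| = |T|\<close>, because the projection \<open>U\<^sup>*U\<close> fixes the range of \<open>|T|\<close>.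
  Conversely, if \<open>U\<^sup>*T\<close> is positive, its square \<open>(U\<^sup>*T)\<^sup>*(U\<^sup>*T) = T\<^sup>*UU\<^sup>*T = T\<^sup>*T\<close> identifies it as \<open>|T|\<close>. In
  this form a polar decomposition can be verified without computing \<open>|T|\<close>.
\<close>

lemma polar_decomposition_iff:
  assumes T: "adjointable T"
  shows "polar_decomposition T U \<longleftrightarrow> partial_isometry U \<and> positive_op (adj U \<circ> T) \<and>
    U \<circ> (adj U \<circ> T) = T \<and> range (adj U \<circ> U) = closure (range (adj T))" (is "?lhs \<longleftrightarrow> ?rhs")
proof
  assume ?lhs
  then have U: "partial_isometry U" and TU: "T = U \<circ> abs_op T"
    and ran: "range (adj U \<circ> U) = closure (range (adj T))"
    using range_proj_onto by (auto simp: polar_decomposition_def)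
  note U' = partial_isometry_simps[OF U]
  define P where "P = adj U \<circ> U"
  have P: "projection P" using U'(4) by (simp add: P_def)
  note P' = projection_simps[OF P] and abs = positive_abs_op[OF T]
  have "adj T y \<in> range P" for y
    unfolding P_def ran by (intro subsetD[OF closure_subset] rangeI)
  then have "P \<circ> adj T = adj T" using P'(4) by auto
  then have "adj (P \<circ> adj T) = T" using adj_adj[OF T] by simp
  then have TP: "T \<circ> P = T" using T P'(1,2) by (simp add: adj_comp adj_adj adjointable_adj)
  \<comment> \<open>The operators \<open>T\<close> and \<open>|T|\<close> have the same kernel.\<close>
  have "abs_op T (P x) = abs_op T x" for x
  proof -
    let ?w = "P x - x"
    have "T ?w = 0" using TP by (simp add: adjointable_additive T fun_eq_iff)
    moreover have "abs_op T (abs_op T ?w) = adj T (T ?w)"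
      using abs_op_square[OF T] by (metis comp_apply)
    ultimately have "abs_op T (abs_op T ?w) = 0"
      by (simp add: adjointable_additive adjointable_adj T)
    then have "ip (abs_op T ?w) (abs_op T ?w) = 0"
      using positive_op_adjointable[OF abs] positive_op_adj[OF abs] ip_adj[of "abs_op T" ?w]
        bounded_bilinear.zero_right[OF bounded_bilinear_ip] by metis
    then have "abs_op T ?w = 0" by (rule ip_definite)
    then show ?thesis using positive_op_adjointable[OF abs] by (simp add: adjointable_additive)
  qed
  then have "adj (abs_op T \<circ> P) = adj (abs_op T)" by (simp add: comp_def)
  then have "P \<circ> abs_op T = abs_op T"
    using positive_op_adjointable[OF abs] positive_op_adj[OF abs] P'(1,2) by (simp add: adj_comp)
  then have UT: "adj U \<circ> T = abs_op T"
    using arg_cong[OF TU, of "\<lambda>X. adj U \<circ> X"] by (simp add: P_def o_assoc)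
  show ?rhs using U ran abs TU[symmetric] by (simp add: UT)
next
  assume rhs: ?rhs
  then have U: "partial_isometry U" by blast
  note U' = partial_isometry_simps[OF U]
  have N: "positive_op (adj U \<circ> T)" using rhs by blast
  have "adj T \<circ> U = adj U \<circ> T"
    using positive_op_adj[OF N] T U'(1) by (simp add: adj_comp adj_adj adjointable_adj)
  then have "(adj U \<circ> T) \<circ> (adj U \<circ> T) = adj T \<circ> (U \<circ> (adj U \<circ> T))"
    by (simp only: o_assoc)
  then have "adj U \<circ> T = abs_op T"
    using abs_op_unique[OF T N] rhs by simp
  then show ?lhs
    unfolding polar_decomposition_def
    using U rhs projection_range_complemented[OF U'(4)] by simp
qed

text \<open>
  The operator identities are stated pointwise so that they rewrite inside
  longer composites irrespective of bracketing.
\<close>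

lemma polar_decomposition_simps:
  assumes T: "adjointable T" and pol: "polar_decomposition T U"
  shows "U (adj U (T x)) = T x" "adj T (U x) = adj U (T x)"
    "adj T (U (adj U x)) = adj T x" "adj U (U (adj T x)) = adj T x"
    "abs_op T = adj U \<circ> T" "range (abs_op T) = range (adj T)"
    "range (adj U \<circ> U) = closure (range (adj T))"
proof -
  have U: "partial_isometry U" and N: "positive_op (adj U \<circ> T)" and UUT: "U \<circ> (adj U \<circ> T) = T"
    and ran: "range (adj U \<circ> U) = closure (range (adj T))"
    using pol polar_decomposition_iff[OF T] by auto
  note U' = partial_isometry_simps[OF U]
  show "U (adj U (T x)) = T x" using UUT by (metis comp_apply)
  have "adj T \<circ> U = adj U \<circ> T"
    using positive_op_adj[OF N] T U'(1) by (simp add: adj_comp adj_adj adjointable_adj)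
  then show TU: "adj T (U x) = adj U (T x)" for x by (metis comp_apply)
  have "adj (U \<circ> (adj U \<circ> T)) = adj T" using UUT by simp
  then have "adj T \<circ> U \<circ> adj U = adj T"
    using T U'(1) by (simp add: adj_comp adj_adj adjointable_intros)
  then show TUU: "adj T (U (adj U x)) = adj T x" for x by (metis comp_apply)
  show "adj U (U (adj T x)) = adj T x"
  proof -
    have "adj T x \<in> range (adj U \<circ> U)" unfolding ran by (intro subsetD[OF closure_subset] rangeI)
    then show ?thesis using projection_simps(4)[OF U'(4)] by simp
  qed
  have UT: "T = U \<circ> abs_op T" and "adj U \<circ> U = proj_onto (closure (range (adj T)))"
    using pol by (auto simp: polar_decomposition_def)
  have "(adj U \<circ> T) \<circ> (adj U \<circ> T) = adj T \<circ> T"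
  proof
    fix x
    have "adj U (T (adj U (T x))) = adj T (U (adj U (T x)))" by (rule TU[symmetric])
    also have "U (adj U (T x)) = T x" using UUT by (metis comp_apply)
    finally show "((adj U \<circ> T) \<circ> (adj U \<circ> T)) x = (adj T \<circ> T) x" by simp
  qed
  then show abs: "abs_op T = adj U \<circ> T" using abs_op_unique[OF T N] by simp
  have "abs_op T x \<in> range (adj T)" for x by (simp add: abs flip: TU)
  moreover have "adj T x \<in> range (abs_op T)" for x
    unfolding abs using TU TUU by (metis comp_apply rangeI)
  ultimately show "range (abs_op T) = range (adj T)" by auto
  show "range (adj U \<circ> U) = closure (range (adj T))" by (fact ran)
qed

text \<open>
  The positive factor \<open>UT\<^sup>*\<close> is \<open>|T\<^sup>*| = U|T|U\<^sup>*\<close>.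
\<close>

lemma polar_decomposition_adj:
  assumes T: "adjointable T" and pol: "polar_decomposition T U"
  shows "polar_decomposition (adj T) (adj U)"
proof -
  note t = polar_decomposition_simps[OF T pol]
  have U: "partial_isometry U" using pol by (simp add: polar_decomposition_def)
  note U' = partial_isometry_simps[OF U]
  show ?thesis
    unfolding polar_decomposition_iff[OF adjointable_adj[OF T]] adj_adj[OF T] adj_adj[OF U'(1)]
  proof (intro conjI)
    show "partial_isometry (adj U)"
      using U' by (simp add: partial_isometry_def adj_adj adjointable_adj)
    have "U \<circ> adj T = adj (adj U) \<circ> abs_op T \<circ> adj U"
      by (auto simp: t adj_adj U' simp flip: t(2))
    then show "positive_op (U \<circ> adj T)"
      using positive_op_conj[OF positive_abs_op[OF T] adjointable_adj[OF U'(1)]] by simp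
    show "adj U \<circ> (U \<circ> adj T) = adj T" by (auto simp: t)
    show "range (U \<circ> adj U) = closure (range T)"
    proof
      have "U ` range (abs_op T) \<subseteq> closure (range T)"
        by (auto simp: t intro: subsetD[OF closure_subset])
      then have "U ` closure (range (adj T)) \<subseteq> closure (range T)"
        unfolding t(6) by (intro image_closure_subset adjointable_continuous U'(1)) auto
      moreover have "adj U y \<in> closure (range (adj T))" for y
        unfolding t(7)[symmetric] using U'(3) by (metis comp_apply rangeI)
      ultimately show "range (U \<circ> adj U) \<subseteq> closure (range T)" by auto
      have "range T \<subseteq> range (U \<circ> adj U)"
        by (rule image_subsetI) (metis comp_apply rangeI t(1))
      then show "closure (range T) \<subseteq> range (U \<circ> adj U)"
        by (intro closure_minimal closed_range_projection U'(5))
    qed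
  qed
qed

lemma polar_decomposition_unique:
  assumes T: "adjointable T" and pol: "polar_decomposition T U" "polar_decomposition T V"
  shows "U = V"
proof
  fix x
  have U: "partial_isometry U" and V: "partial_isometry V" 
    and TU: "T = U \<circ> abs_op T" and TV: "T = V \<circ> abs_op T"
    and P: "adj U \<circ> U = adj V \<circ> V"
    using pol by (auto simp: polar_decomposition_def)
  note U' = partial_isometry_simps[OF U] and V' = partial_isometry_simps[OF V]
  have "range (abs_op T) \<subseteq> {y. U y = V y}"
    using TU TV by (auto simp: fun_eq_iff) 
  then have "closure (range (abs_op T)) \<subseteq> {y. U y = V y}"
    by (intro closure_minimal closed_Collect_eq adjointable_continuous U' V')
  moreover have "adj U (U x) \<in> closure (range (abs_op T))"
    using polar_decomposition_simps(6,7)[OF T pol(1)] by auto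
  ultimately have "U (adj U (U x)) = V (adj U (U x))" by blast
  then show "U x = V x" using U'(2) V'(2) P by (metis comp_apply)
qed

text \<open>
  Write \<open>K = |T|\<close>, \<open>D = |S\<^sup>*|\<close>, \<open>P = U\<^sup>*U\<close> and \<open>Q = VV\<^sup>*\<close>; \<open>P\<close> and \<open>Q\<close> are the projections onto the closures of
  the ranges of \<open>K\<close> and \<open>D\<close>. By assumption the squares of \<open>K\<close> and \<open>D\<close> commute, hence so do \<open>K\<close> and \<open>D\<close>, and
  with them \<open>P\<close> and \<open>Q\<close>. This makes \<open>(UV)\<^sup>*UV = V\<^sup>*PV\<close> a projection and \<open>(UV)\<^sup>*TS = V\<^sup>*KDV\<close> positive, which
  are the main points of the criterion \<open>polar_decomposition_iff\<close>.
\<close>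

lemma polar_decomposition_comp:
  assumes T: "adjointable T" and S: "adjointable S"
    and polT: "polar_decomposition T U" and polS: "polar_decomposition S V"
    and comm: "adj T \<circ> T \<circ> (S \<circ> adj S) = S \<circ> adj S \<circ> (adj T \<circ> T)"
  shows "polar_decomposition (T \<circ> S) (U \<circ> V)"
proof -
  have polS': "polar_decomposition (adj S) (adj V)" by (rule polar_decomposition_adj[OF S polS])
  note S' = adjointable_adj[OF S]
  note t = polar_decomposition_simps[OF T polT] and s = polar_decomposition_simps[OF S polS]
  note s' = polar_decomposition_simps[OF S' polS']
  have U: "partial_isometry U" and V: "partial_isometry V"
    using polT polS by (auto simp: polar_decomposition_def)
  note u = partial_isometry_simps[OF U] and v = partial_isometry_simps[OF V]
  define K D P Q where "K = abs_op T" and "D = abs_op (adj S)" and "P = adj U \<circ> U" and "Q = V \<circ> adj V"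
  have K: "positive_op K" and D: "positive_op D"
    using positive_abs_op T S' by (auto simp: K_def D_def)
  note K' = positive_op_adjointable[OF K] positive_op_adj[OF K]
    and D' = positive_op_adjointable[OF D] positive_op_adj[OF D]
  have P: "projection P" and Q: "projection Q"
    using u(4) v(5) by (auto simp: P_def Q_def)
  note P' = projection_simps[OF P] and Q' = projection_simps[OF Q]
  have K_app: "K x = adj U (T x)" for x by (simp add: K_def t)
  have D_app: "D x = V (adj S x)" for x by (simp add: D_def s' adj_adj v)
  have D_app': "D x = S (adj V x)" for x
    using s'(2)[of x] by (simp add: D_app adj_adj S v)
  have "S \<circ> adj S \<circ> K = K \<circ> (S \<circ> adj S)"
    unfolding K_def using comm by (intro abs_op_commute T adjointable_comp S S') simp
  then have KD: "K \<circ> D = D \<circ> K"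
    unfolding D_def using abs_op_commute[OF S' K'(1)] by (simp add: adj_adj S)
  have ranQ: "range Q = closure (range D)"
    using s'(6,7) by (simp add: Q_def D_def adj_adj v)
  have ranP: "range P = closure (range K)"
    using t(6,7) by (simp add: P_def K_def)
  have KQ: "K \<circ> Q = Q \<circ> K" by (rule projection_commute[OF K' Q ranQ KD])
  have DP: "D \<circ> P = P \<circ> D" by (rule projection_commute[OF D' P ranP KD[symmetric]])
  have QP: "Q \<circ> P = P \<circ> Q" by (rule projection_commute[OF Q'(1,2) P ranP KQ[symmetric]])
  have W: "adjointable (U \<circ> V)" "adj (U \<circ> V) = adj V \<circ> adj U"
    using u(1) v(1) by (simp_all add: adjointable_comp adj_comp)
  have TS: "adj (T \<circ> S) = adj S \<circ> adj T" using T S by (simp add: adj_comp)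
  have WW: "(adj V \<circ> adj U \<circ> (U \<circ> V)) x = adj V (P (V x))" for x by (simp add: P_def)
  have Qv: "Q (V x) = V x" for x by (simp add: Q_def v)
  have VDS: "adj V (D x) = adj S x" and DV: "D (V x) = S x" for x
    by (simp_all add: D_app s)
  have DPx: "P (D x) = D (P x)" and QPx: "Q (P x) = P (Q x)" and KQx: "K (Q x) = Q (K x)"
    and KDx: "K (D x) = D (K x)" for x
    using DP QP KQ KD by (auto simp: fun_eq_iff)
  have WW_proj: "projection (adj V \<circ> adj U \<circ> (U \<circ> V))"
    unfolding projection_def
  proof (intro conjI)
    show "adjointable (adj V \<circ> adj U \<circ> (U \<circ> V))" "adj (adj V \<circ> adj U \<circ> (U \<circ> V)) = adj V \<circ> adj U \<circ> (U \<circ> V)"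
      using u(1) v(1) by (simp_all add: adjointable_intros adj_comp adj_adj o_assoc)
    have "adj V (P (V (adj V (P (V x))))) = adj V (P (V x))" for x
    proof -
      have "V (adj V (P (V x))) = P (V x)"
        using QPx[of "V x"] Qv[of x] by (simp add: Q_def)
      then show ?thesis by (simp add: P')
    qed
    then show "adj V \<circ> adj U \<circ> (U \<circ> V) \<circ> (adj V \<circ> adj U \<circ> (U \<circ> V)) = adj V \<circ> adj U \<circ> (U \<circ> V)"
      by (auto simp: P_def)
  qed
  show ?thesis
    unfolding polar_decomposition_iff[OF adjointable_comp[OF T S]] W TS
  proof (intro conjI)
    show "partial_isometry (U \<circ> V)" using W WW_proj by (simp add: partial_isometry_def)
    have "adj V \<circ> adj U \<circ> (T \<circ> S) = adj V \<circ> (K \<circ> D) \<circ> V" by (auto simp: DV K_app)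
    then show "positive_op (adj V \<circ> adj U \<circ> (T \<circ> S))"
      using positive_op_conj[OF positive_op_comp[OF K D KD] v(1)] by simp
    have "U (Q (K (S x))) = T (S x)" for x
    proof -
      have "Q (S x) = S x" by (simp add: Q_def s)
      then show ?thesis by (simp flip: KQx) (simp add: K_app t)
    qed
    then show "U \<circ> V \<circ> (adj V \<circ> adj U \<circ> (T \<circ> S)) = T \<circ> S" by (auto simp: Q_def K_app)
    show "range (adj V \<circ> adj U \<circ> (U \<circ> V)) = closure (range (adj S \<circ> adj T))"
    proof
      let ?R = "closure (range (adj S \<circ> adj T))"
      \<comment> \<open>The vector \<open>V x\<close> is approximated by vectors \<open>D z\<close>, and \<open>P z\<close> by vectors \<open>T\<^sup>* w\<close>. Then
        \<open>V\<^sup>*P(D z) = V\<^sup>*D(P z)\<close> is approximated by \<open>V\<^sup>*DT\<^sup>*w = S\<^sup>*T\<^sup>*w\<close>.\<close>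
      have "(adj V \<circ> D) ` range (adj T) \<subseteq> ?R"
        by (auto simp: VDS intro: subsetD[OF closure_subset])
      then have "(adj V \<circ> D) ` closure (range (adj T)) \<subseteq> ?R"
        by (intro image_closure_subset adjointable_continuous adjointable_comp adjointable_adj v D') auto
      moreover have "P z \<in> closure (range (adj T))" for z
        using ranP t(6) by (auto simp: K_def)
      ultimately have "(adj V \<circ> P) ` range D \<subseteq> ?R" by (auto simp: DPx)
      then have "(adj V \<circ> P) ` closure (range D) \<subseteq> ?R"
        by (intro image_closure_subset adjointable_continuous adjointable_comp adjointable_adj v P') auto
      moreover have "V x \<in> closure (range D)" for x
        unfolding ranQ[symmetric] using Q'(4) Qv by blast
      ultimately show "range (adj V \<circ> adj U \<circ> (U \<circ> V)) \<subseteq> ?R" by (auto simp: P_def)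
      have "(adj V \<circ> adj U \<circ> (U \<circ> V)) ((adj S \<circ> adj T) x) = (adj S \<circ> adj T) x" for x
      proof -
        have "P (adj T x) = adj T x" by (simp add: P_def t)
        then show ?thesis unfolding WW by (simp add: DPx VDS flip: D_app)
      qed
      then have "range (adj S \<circ> adj T) \<subseteq> range (adj V \<circ> adj U \<circ> (U \<circ> V))"
        by (intro image_subsetI) (metis rangeI)
      then show "?R \<subseteq> range (adj V \<circ> adj U \<circ> (U \<circ> V))"
        by (intro closure_minimal closed_range_projection WW_proj)
    qed
  qed
qed

text \<open>
  With \<open>K\<close>, \<open>D\<close>, \<open>P\<close>, \<open>Q\<close> as before, \<open>V\<^sup>*PV\<close> is idempotent, that is \<open>QPQPQ = QPQ\<close>, which forces \<open>PQ = QP\<close>.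
  Self-adjointness of \<open>(UV)\<^sup>*TS = V\<^sup>*KS\<close> gives \<open>DKQ = QKD\<close>, and \<open>TS = UV(UV)\<^sup>*TS\<close> gives \<open>KD = QKD\<close>. Hence
  \<open>KD = DKQ\<close>, and taking adjoints \<open>DK = QKD = KD\<close>.
\<close>

lemma polar_decomposition_comp_imp_commute:
  assumes T: "adjointable T" and S: "adjointable S"
    and polT: "polar_decomposition T U" and polS: "polar_decomposition S V"
    and pol: "polar_decomposition (T \<circ> S) (U \<circ> V)"
  shows "adj T \<circ> T \<circ> (S \<circ> adj S) = S \<circ> adj S \<circ> (adj T \<circ> T)"
proof -
  have polS': "polar_decomposition (adj S) (adj V)" by (rule polar_decomposition_adj[OF S polS])
  note S' = adjointable_adj[OF S]
  note t = polar_decomposition_simps[OF T polT] and s = polar_decomposition_simps[OF S polS]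
  note s' = polar_decomposition_simps[OF S' polS', unfolded adj_adj[OF S]]
  have U: "partial_isometry U" and V: "partial_isometry V" and W: "partial_isometry (U \<circ> V)"
    using polT polS pol by (auto simp: polar_decomposition_def)
  note u = partial_isometry_simps[OF U] and v = partial_isometry_simps[OF V]
  note W' = partial_isometry_simps[OF W] and ts = polar_decomposition_simps[OF adjointable_comp[OF T S] pol]
  have adjW: "adj (U \<circ> V) = adj V \<circ> adj U" using u(1) v(1) by (simp add: adj_comp)
  define K D P Q where "K = abs_op T" and "D = abs_op (adj S)" and "P = adj U \<circ> U" and "Q = V \<circ> adj V"
  have K: "positive_op K" and D: "positive_op D"
    using positive_abs_op T S' by (auto simp: K_def D_def)
  note K' = positive_op_adjointable[OF K] positive_op_adj[OF K]
    and D' = positive_op_adjointable[OF D] positive_op_adj[OF D]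
  have P: "projection P" and Q: "projection Q"
    using u(4) v(5) by (auto simp: P_def Q_def)
  note P' = projection_simps[OF P] and Q' = projection_simps[OF Q]
  have K_app: "K x = adj U (T x)" for x by (simp add: K_def t)
  have D_app: "D x = V (adj S x)" for x by (simp add: D_def s' adj_adj v)
  have D_app': "D x = S (adj V x)" for x
    using s'(2)[of x] by (simp add: D_app adj_adj v)
  have PK: "P (K x) = K x" for x by (simp add: P_def K_app u)
  have "Q (P (Q (P (Q x)))) = Q (P (Q x))" for x
    using projection_simps(3)[OF W'(4), of "adj V x"] by (simp add: adjW P_def Q_def)
  \<comment> \<open>For \<open>X = PQ - QPQ\<close> one has \<open>X\<^sup>*X = QPQ - QPQPQ\<close>.\<close>
  moreover have "ip (P (Q x) - Q (P (Q x))) (P (Q x) - Q (P (Q x)))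
      = ip x (Q (P (Q x)) - Q (P (Q (P (Q x)))))" for x
  proof -
    let ?w = "P (Q x) - Q (P (Q x))"
    have Qw: "Q ?w = 0" by (simp add: adjointable_additive Q')
    have "ip ?w ?w = ip (P (Q x)) ?w - ip (P (Q x)) (Q ?w)"
      using ip_adj[OF Q'(1), of "P (Q x)" ?w] by (simp add: Q' ip_diff_left)
    also have "\<dots> = ip x (Q (P ?w))"
      using ip_adj[OF P'(1)] ip_adj[OF Q'(1)] by (simp add: Qw P' Q' bounded_bilinear.zero_right[OF bounded_bilinear_ip])
    finally show ?thesis by (simp add: adjointable_additive P' Q')
  qed
  ultimately have "ip (P (Q x) - Q (P (Q x))) (P (Q x) - Q (P (Q x))) = 0" for x
    by (simp add: bounded_bilinear.zero_right[OF bounded_bilinear_ip])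
  then have "P (Q x) - Q (P (Q x)) = 0" for x by (rule ip_definite)
  then have PQ: "P \<circ> Q = Q \<circ> P \<circ> Q" by auto
  moreover have "adj (P \<circ> Q) = Q \<circ> P" "adj (Q \<circ> P \<circ> Q) = Q \<circ> P \<circ> Q"
    using P'(1,2) Q'(1,2) by (simp_all add: adj_comp adjointable_comp o_assoc)
  ultimately have "Q \<circ> P = P \<circ> Q" by metis
  then have QP: "Q (P x) = P (Q x)" for x by (metis comp_apply)
  have "adj S (K (V x)) = adj V (K (S x))" for x
    using ts(2)[of x] T S by (simp add: adj_comp adjW K_app t(2))
  then have "V (adj S (K (V (adj V x)))) = V (adj V (K (S (adj V x))))" for x by simp
  moreover have "D (K (Q x)) = V (adj S (K (V (adj V x))))" for x by (simp add: D_app Q_def)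
  moreover have "Q (K (D x)) = V (adj V (K (S (adj V x))))" for x by (simp add: D_app' Q_def)
  ultimately have DKQ: "D (K (Q x)) = Q (K (D x))" for x by simp
  have QKD: "Q (K (D x)) = K (D x)" for x
  proof -
    have "U (Q (K (D x))) = T (D x)"
      using ts(1)[of "adj V x"] by (simp add: adjW Q_def K_app D_app')
    then have "P (Q (K (D x))) = K (D x)" by (simp add: P_def K_app)
    then show ?thesis by (simp add: PK flip: QP)
  qed
  have "D \<circ> K \<circ> Q = K \<circ> D" using DKQ QKD by auto
  then have "adj (D \<circ> K \<circ> Q) = adj (K \<circ> D)" by simp
  then have "Q \<circ> (K \<circ> D) = D \<circ> K" using K' D' Q'(1,2) by (simp add: adj_comp adjointable_comp)
  then have KD: "K (D x) = D (K x)" for x using QKD by (metis comp_apply)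
  have KK: "K (K x) = adj T (T x)" for x
    using abs_op_square[OF T] by (metis K_def comp_apply)
  have DD: "D (D x) = S (adj S x)" for x
    using abs_op_square[OF S'] by (metis D_def adj_adj[OF S] comp_apply)
  show ?thesis by (auto simp: KD simp flip: KK DD)
qed

section \<open>Centered operators\<close>

text \<open>
  Both identities hold because \<open>X(X\<^sup>*X)(YY\<^sup>*)X\<^sup>*\<close> and \<open>Y\<^sup>*(X\<^sup>*X)(YY\<^sup>*)Y\<close> may be read with the middle factors in
  either order. They reduce the relations between \<open>T\<^sup>jT\<^sup>j\<^sup>*\<close> and \<open>T\<^sup>kT\<^sup>k\<^sup>*\<close>, and those between \<open>T\<^sup>j\<^sup>*T\<^sup>j\<close> and
  \<open>T\<^sup>k\<^sup>*T\<^sup>k\<close>, to the mixed ones.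
\<close>

lemma commute_with_product:
  assumes X: "adjointable X" and Y: "adjointable Y"
    and comm: "adj X \<circ> X \<circ> (Y \<circ> adj Y) = Y \<circ> adj Y \<circ> (adj X \<circ> X)"
  shows "X \<circ> adj X \<circ> (X \<circ> Y \<circ> adj (X \<circ> Y)) = X \<circ> Y \<circ> adj (X \<circ> Y) \<circ> (X \<circ> adj X)"
    and "adj Y \<circ> Y \<circ> (adj (X \<circ> Y) \<circ> (X \<circ> Y)) = adj (X \<circ> Y) \<circ> (X \<circ> Y) \<circ> (adj Y \<circ> Y)"
proof -
  have c: "adj X (X (Y (adj Y x))) = Y (adj Y (adj X (X x)))" for x
    using fun_cong[OF comm, of x] by simp
  show "X \<circ> adj X \<circ> (X \<circ> Y \<circ> adj (X \<circ> Y)) = X \<circ> Y \<circ> adj (X \<circ> Y) \<circ> (X \<circ> adj X)"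
    "adj Y \<circ> Y \<circ> (adj (X \<circ> Y) \<circ> (X \<circ> Y)) = adj (X \<circ> Y) \<circ> (X \<circ> Y) \<circ> (adj Y \<circ> Y)"
    by (auto simp: adj_comp X Y c)
qed

lemma centered_iff:
  assumes T: "adjointable T"
  shows "centered T \<longleftrightarrow> (\<forall>j\<ge>1. \<forall>k\<ge>1.
    adj (T ^^ j) \<circ> T ^^ j \<circ> (T ^^ k \<circ> adj (T ^^ k)) = T ^^ k \<circ> adj (T ^^ k) \<circ> (adj (T ^^ j) \<circ> T ^^ j))"
    (is "_ \<longleftrightarrow> ?comm")
proof
  assume "centered T"
  then show ?comm unfolding centered_def Let_def by blast
next
  assume comm: ?comm
  define A B where "A k = T ^^ k \<circ> adj (T ^^ k)" and "B k = adj (T ^^ k) \<circ> T ^^ k" for k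
  have BA: "B j \<circ> A k = A k \<circ> B j" if "j \<ge> 1" "k \<ge> 1" for j k
    using comm that by (simp add: A_def B_def)
  have less: "A j \<circ> A k = A k \<circ> A j \<and> B j \<circ> B k = B k \<circ> B j" if "1 \<le> j" "j < k" for j k
  proof -
    have pos: "k - j \<ge> 1" using that by simp
    have k: "T ^^ k = T ^^ j \<circ> T ^^ (k - j)" "T ^^ k = T ^^ (k - j) \<circ> T ^^ j"
      using that by (simp_all flip: funpow_add)
    have "A j \<circ> A k = A k \<circ> A j"
      unfolding A_def k(1)
      by (rule commute_with_product(1)) (use BA[OF that(1) pos] T in \<open>simp_all add: A_def B_def adjointable_funpow\<close>)
    moreover have "B j \<circ> B k = B k \<circ> B j"
      unfolding B_def k(2)
      by (rule commute_with_product(2)) (use BA[OF pos that(1)] T in \<open>simp_all add: A_def B_def adjointable_funpow\<close>)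
    ultimately show ?thesis ..
  qed
  have "A j \<circ> A k = A k \<circ> A j \<and> B j \<circ> B k = B k \<circ> B j" if "1 \<le> j" "1 \<le> k" for j k
    using less[of j k] less[of k j] that by (cases j k rule: linorder_cases) auto
  then show "centered T"
    unfolding centered_def Let_def A_def[symmetric] B_def[symmetric] using BA by fastforce
qed

lemma centered_iff_polar_decomposition_powers:
  assumes T: "adjointable T" and pol: "polar_decomposition T U"
  shows "centered T \<longleftrightarrow> (\<forall>k\<ge>1. polar_decomposition (T ^^ k) (U ^^ k))"
proof
  assume cent: "centered T"
  show "\<forall>k\<ge>1. polar_decomposition (T ^^ k) (U ^^ k)"
  proof (intro allI impI)
    fix k :: nat assume "k \<ge> 1"
    then show "polar_decomposition (T ^^ k) (U ^^ k)"
    proof (induction k rule: dec_induct)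
      case (step k)
      have "adj T \<circ> T \<circ> (T ^^ k \<circ> adj (T ^^ k)) = T ^^ k \<circ> adj (T ^^ k) \<circ> (adj T \<circ> T)"
        using cent[unfolded centered_iff[OF T], rule_format, of 1 k] step.hyps by simp
      from polar_decomposition_comp[OF T adjointable_funpow[OF T] pol step.IH this]
      show ?case by (simp only: funpow.simps)
    qed (use pol in simp)
  qed
next
  assume powers: "\<forall>k\<ge>1. polar_decomposition (T ^^ k) (U ^^ k)"
  show "centered T"
    unfolding centered_iff[OF T]
  proof (intro allI impI)
    fix j k :: nat assume jk: "j \<ge> 1" "k \<ge> 1"
    show "adj (T ^^ j) \<circ> T ^^ j \<circ> (T ^^ k \<circ> adj (T ^^ k)) = T ^^ k \<circ> adj (T ^^ k) \<circ> (adj (T ^^ j) \<circ> T ^^ j)"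
    proof (rule polar_decomposition_comp_imp_commute[OF adjointable_funpow[OF T] adjointable_funpow[OF T]])
      show "polar_decomposition (T ^^ j) (U ^^ j)" "polar_decomposition (T ^^ k) (U ^^ k)"
        using powers jk by auto
      show "polar_decomposition (T ^^ j \<circ> T ^^ k) (U ^^ j \<circ> U ^^ k)"
        using powers[rule_format, of "j + k"] jk by (simp add: funpow_add)
    qed
  qed
qed

lemma polar_decomposition_powers_iff_n_centered:
  assumes T: "adjointable T" and pol: "polar_decomposition T U"
  shows "(\<forall>k\<ge>1. polar_decomposition (T ^^ k) (U ^^ k)) \<longleftrightarrow> (\<forall>n\<ge>1. n_centered n T)"
proof
  assume "\<forall>k\<ge>1. polar_decomposition (T ^^ k) (U ^^ k)"
  then show "\<forall>n\<ge>1. n_centered n T"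
    unfolding n_centered_def using pol by auto
next
  assume cent: "\<forall>n\<ge>1. n_centered n T"
  show "\<forall>k\<ge>1. polar_decomposition (T ^^ k) (U ^^ k)"
  proof (intro allI impI)
    fix k :: nat assume k: "k \<ge> 1"
    then obtain V where "polar_decomposition T V" "\<forall>j\<in>{1..k}. polar_decomposition (T ^^ j) (V ^^ j)"
      using cent n_centered_def by blast
    then show "polar_decomposition (T ^^ k) (U ^^ k)"
      using polar_decomposition_unique[OF T pol] k by auto
  qed
qed

end

theorem corollary4p5:
  fixes act :: "'h::complex_banach \<Rightarrow> 'a::cstar_algebra \<Rightarrow> 'h"
    and ip :: "'h \<Rightarrow> 'h \<Rightarrow> 'a"
    and T U :: "'h \<Rightarrow> 'h"
  assumes "hilbert_module act ip"
    and "hilbert_module.adjointable ip T"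
    and "hilbert_module.polar_decomposition act ip T U"
  shows "(hilbert_module.centered ip T \<longleftrightarrow>
           (\<forall>k\<ge>1. hilbert_module.polar_decomposition act ip (T ^^ k) (U ^^ k))) \<and>
         ((\<forall>k\<ge>1. hilbert_module.polar_decomposition act ip (T ^^ k) (U ^^ k)) \<longleftrightarrow>
           (\<forall>n\<ge>1. hilbert_module.n_centered act ip n T))"
proof -
  interpret hilbert_module act ip by fact
  show ?thesis
    using centered_iff_polar_decomposition_powers[OF assms(2,3)]
      polar_decomposition_powers_iff_n_centered[OF assms(2,3)] by blast
qed

end
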